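(* For every integer $d \ge 1$ there exist a translation-equivariant matching rule $\Phi$ on $\mathbb{Z}^d$ (for independent fair coin-flips) and a constant $c = c(d) < \infty$ such that for all $r \ge 2$, $$\mathbb{P}(Z_\Phi > r) \le c\,(\log r)^4\, r^{-\beta}, \qquad \text{where } \beta = \beta(d) = \frac{2}{1 + \frac{4}{d}}.$$
   Context: Let $\Omega = \{0,1\}^{\mathbb{Z}^d}$ with its product $\sigma$-algebra $\mathcal{F}$, and let $\mathbb{P}$ be the product measure with parameter $p = 1/2$. For $\gamma \in \Omega$, a bijection $\phi : \mathbb{Z}^d \to \mathbb{Z}^d$ is a matching on $\gamma$ if $\phi\circ\phi$ is the identity and every site $x$ with $\gamma(x)=1$ is mapped to a site $y$ with $\gamma(y)=0$ and vice versa. For $z \in \mathbb{Z}^d$ set $\theta^z x = x + z$ for $x\in\mathbb{Z}^d$ and $(\theta^z\gamma)(x) = \gamma(x-z)$ for $\gamma \in \Omega$. A measurable map $\Phi : \Omega \times \mathbb{Z}^d \to \mathbb{Z}^d$ is a matching rule if $\Phi(\gamma,\cdot)$ is a matching on $\gamma$ for $\mathbb{P}$-almost every $\gamma$. It is translation-equivariant if it commutes with translations: for every $z\in\mathbb{Z}^d$ and $\mathbb{P}$-almost every $\gamma$, $\Phi(\theta^z\gamma, \theta^z x) = \theta^z\Phi(\gamma,x)$ for all $x\in\mathbb{Z}^d$. Let $\|\cdot\|$ be the $\ell^\infty$ norm, $\mathcal{O}$ the origin, and $Z_\Phi(\gamma) = \|\Phi(\gamma,\mathcal{O})\|$. *)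

theory Defs
  imports "HOL-Probability.Probability"
begin

type_synonym 'd site = "int ^ 'd"

text \<open>Coin values are booleans, with \<open>True\<close> for 1 and \<open>False\<close> for 0.\<close>

type_synonym 'd config = "'d site \<Rightarrow> bool"

definition coin_measure :: "('d::finite) config measure" where
  "coin_measure = (\<Pi>\<^sub>M x\<in>UNIV. measure_pmf (bernoulli_pmf (1/2)))"

definition matching_on :: "('d::finite) config \<Rightarrow> ('d site \<Rightarrow> 'd site) \<Rightarrow> bool" where
  "matching_on \<gamma> \<phi> \<longleftrightarrow>
     bij \<phi> \<and> \<phi> \<circ> \<phi> = id \<and>
     (\<forall>x. \<gamma> x \<longrightarrow> \<not> \<gamma> (\<phi> x)) \<and> (\<forall>x. \<not> \<gamma> x \<longrightarrow> \<gamma> (\<phi> x))"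

definition site_shift :: "('d::finite) site \<Rightarrow> 'd site \<Rightarrow> 'd site" where
  "site_shift z x = x + z"

definition config_shift :: "('d::finite) site \<Rightarrow> 'd config \<Rightarrow> 'd config" where
  "config_shift z \<gamma> = (\<lambda>x. \<gamma> (x - z))"

definition matching_rule :: "(('d::finite) config \<Rightarrow> 'd site \<Rightarrow> 'd site) \<Rightarrow> bool" where
  "matching_rule \<Phi> \<longleftrightarrow>
     case_prod \<Phi> \<in> coin_measure \<Otimes>\<^sub>M count_space UNIV \<rightarrow>\<^sub>M count_space UNIV \<and>
     (AE \<gamma> in coin_measure. matching_on \<gamma> (\<Phi> \<gamma>))"

definition translation_equivariant ::
    "(('d::finite) config \<Rightarrow> 'd site \<Rightarrow> 'd site) \<Rightarrow> bool" where
  "translation_equivariant \<Phi> \<longleftrightarrow>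
     (\<forall>z. AE \<gamma> in coin_measure. \<forall>x.
        \<Phi> (config_shift z \<gamma>) (site_shift z x) = site_shift z (\<Phi> \<gamma> x))"

definition linf_norm :: "int ^ ('d::finite) \<Rightarrow> int" where
  "linf_norm x = (MAX i. \<bar>x $ i\<bar>)"

definition match_dist :: "(('d::finite) config \<Rightarrow> 'd site \<Rightarrow> 'd site) \<Rightarrow> 'd config \<Rightarrow> int" where
  "match_dist \<Phi> \<gamma> = linf_norm (\<Phi> \<gamma> 0)"

end

theory Submission
  imports Defs
begin

text \<open>
  Seeds of level \<open>n\<close> are the starting points of alternating runs of length about \<open>4 d n\<close> in one fixed
  coordinate direction.  Moving the centre of every level-\<open>n\<close> cell to a level-\<open>(n+1)\<close> seed
  within a fixed distance (and leaving it in place if there is none) yields equivariant partitions of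
  the lattice that become coarser with \<open>n\<close> and whose cells have deterministically bounded radius.
  At stage \<open>n\<close> as many still unmatched sites as possible are matched inside each cell, so by nestedness
  the number of sites left over in a cell is \<open>\<bar>D\<bar>\<close>, where \<open>D\<close> is the sum of the signs of
  all coins in the cell.

  Sending mass from each site to the centre of its cell shows that the origin is unmatched with
  probability \<open>E \<bar>D\<bar> \<le> (l E D\<^sup>2 + P / l) / 2\<close>, with \<open>D\<close> taken over the cell centred at the
  origin and \<open>P\<close> the probability that there is such a cell, which is about the density of the seeds.
  Independence of the signs from the cells is replaced by a symmetry: there are frequent cuts such
  that flipping all coins of a line beyond a cut changes neither the seeds nor the other cuts.  Hence only
  pairs of sites on a line with no cut between them contribute to \<open>E D\<^sup>2\<close>, which is therefore
  bounded.
\<close>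

section \<open>Fair coin flips and finitary functions\<close>

lemma prob_space_coin: "prob_space coin_measure"
  unfolding coin_measure_def by (intro prob_space_PiM) (rule measure_pmf.prob_space_axioms)

lemma space_coin [simp]: "space coin_measure = UNIV"
  unfolding coin_measure_def by (simp add: space_PiM)

lemma emeasure_cylinder:
  assumes "finite J"
  shows "emeasure coin_measure {\<gamma>. \<forall>x\<in>J. \<gamma> x \<in> A x} = (\<Prod>x\<in>J. ennreal (real (card (A x)) / 2))"
proof -
  let ?M = "\<lambda>_::'a site. measure_pmf (bernoulli_pmf (1/2))"
  have "emeasure coin_measure {\<gamma>. \<forall>x\<in>J. \<gamma> x \<in> A x} =
        emeasure (Pi\<^sub>M UNIV ?M) (prod_emb UNIV ?M J (Pi\<^sub>E J A))"
    unfolding coin_measure_def by (rule arg_cong) (auto simp: prod_emb_def PiE_iff)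
  also have "\<dots> = (\<Prod>i\<in>J. emeasure (?M i) (A i))"
    by (rule emeasure_PiM_emb) (auto intro: assms measure_pmf.prob_space_axioms)
  also have "\<dots> = (\<Prod>x\<in>J. ennreal (real (card (A x)) / 2))"
  proof (rule prod.cong)
    fix x
    have "emeasure (?M x) (A x) = ennreal (\<Sum>b\<in>A x. pmf (bernoulli_pmf (1/2)) b)"
      by (rule emeasure_measure_pmf_finite) simp
    also have "(\<Sum>b\<in>A x. pmf (bernoulli_pmf (1/2)) b) = (\<Sum>b\<in>A x. 1/2)"
    proof (rule sum.cong[OF refl])
      fix b show "pmf (bernoulli_pmf (1/2)) b = 1/2" by (cases b) simp_all
    qed
    also have "\<dots> = real (card (A x)) / 2" by simp
    finally show "emeasure (?M x) (A x) = ennreal (real (card (A x)) / 2)" .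
  qed simp
  finally show ?thesis .
qed

lemma cylinder_sets:
  assumes "finite J"
  shows "{\<gamma>. \<forall>x\<in>J. \<gamma> x \<in> A x} \<in> sets coin_measure"
proof -
  let ?M = "\<lambda>_::'a site. measure_pmf (bernoulli_pmf (1/2))"
  have "{\<gamma>. \<forall>x\<in>J. \<gamma> x \<in> A x} = prod_emb UNIV ?M J (Pi\<^sub>E J A)"
    by (auto simp: prod_emb_def PiE_iff)
  then show ?thesis
    using sets_PiM_I[of J UNIV A ?M] assms by (simp add: coin_measure_def)
qed

lemma measurable_coord [measurable]: "(\<lambda>\<gamma>. \<gamma> x) \<in> measurable coin_measure (count_space UNIV)"
proof -
  have "(\<lambda>\<gamma>. \<gamma> x) \<in> measurable coin_measure (measure_pmf (bernoulli_pmf (1/2)))"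
    unfolding coin_measure_def by (rule measurable_component_singleton) simp
  then show ?thesis by simp
qed

text \<open>A cylinder over \<open>J\<close> pulls back to a cylinder over the image of
  \<open>J\<close> under \<open>\<pi>\<close>, and each one-coin event keeps its cardinality, hence
  its probability. Empty \<open>S\<close> gives translations; the identity as \<open>\<pi>\<close>
  gives sign flips.\<close>

lemma distr_coin_reindex_flip:
  assumes "inj \<pi>"
  shows "distr coin_measure coin_measure (\<lambda>\<gamma> x. \<gamma> (\<pi> x) \<noteq> (x \<in> S)) = coin_measure" (is "?D = _")
proof -
  let ?M = "\<lambda>_::'a site. measure_pmf (bernoulli_pmf (1/2))"
  let ?T = "\<lambda>\<gamma> x. \<gamma> (\<pi> x) \<noteq> (x \<in> S)"
  have T: "?T \<in> measurable coin_measure coin_measure"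
  proof -
    have "?T \<in> measurable coin_measure (Pi\<^sub>M UNIV ?M)"
      by (rule measurable_PiM_single') (auto intro!: measurable_compose[OF measurable_coord])
    then show ?thesis by (simp add: coin_measure_def)
  qed
  have s: "sets ?D = sets (Pi\<^sub>M UNIV ?M)" by (simp add: coin_measure_def)
  have "Pi\<^sub>M UNIV ?M = ?D"
  proof (rule measure_eqI_PiM_infinite[OF refl s])
    show "finite_measure (Pi\<^sub>M UNIV ?M)"
      using prob_space_coin unfolding coin_measure_def prob_space_def by blast
    fix A :: "'a site \<Rightarrow> bool set" and J :: "'a site set"
    assume J: "finite J"
    have emb: "prod_emb UNIV ?M J (Pi\<^sub>E J A) = {\<gamma>. \<forall>x\<in>J. \<gamma> x \<in> A x}"
      by (auto simp: prod_emb_def PiE_iff)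
    note meas = cylinder_sets[OF J, of A]
    let ?A' = "\<lambda>x. {b. (b \<noteq> (inv \<pi> x \<in> S)) \<in> A (inv \<pi> x)}"
    have card: "card {b. (b \<noteq> c) \<in> X} = card X" for c :: bool and X :: "bool set"
    proof -
      have "bij_betw (\<lambda>b. b \<noteq> c) {b. (b \<noteq> c) \<in> X} X"
        by (rule bij_betwI[where g="\<lambda>b. b \<noteq> c"]) (cases c; simp)+
      then show ?thesis by (rule bij_betw_same_card)
    qed
    have "emeasure ?D {\<gamma>. \<forall>x\<in>J. \<gamma> x \<in> A x} = emeasure coin_measure {\<gamma>. \<forall>x\<in>J. ?T \<gamma> x \<in> A x}"
      using emeasure_distr[OF T meas] by (simp add: vimage_def)
    also have "{\<gamma>. \<forall>x\<in>J. ?T \<gamma> x \<in> A x} = {\<gamma>. \<forall>x\<in>\<pi> ` J. \<gamma> x \<in> ?A' x}"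
      using assms by (auto simp: inv_f_f)
    also have "emeasure coin_measure \<dots> = (\<Prod>x\<in>\<pi> ` J. ennreal (real (card (?A' x)) / 2))"
      using J by (intro emeasure_cylinder) auto
    also have "\<dots> = (\<Prod>x\<in>J. ennreal (real (card (A x)) / 2))"
      by (subst prod.reindex[OF inj_on_subset[OF assms subset_UNIV]])
        (simp only: o_def card inv_f_f[OF assms])
    also have "\<dots> = emeasure coin_measure {\<gamma>. \<forall>x\<in>J. \<gamma> x \<in> A x}"
      by (rule emeasure_cylinder[OF J, symmetric])
    finally show "emeasure (Pi\<^sub>M UNIV ?M) (prod_emb UNIV ?M J (Pi\<^sub>E J A)) = emeasure ?D (prod_emb UNIV ?M J (Pi\<^sub>E J A))"
      by (simp add: emb coin_measure_def)
  qed
  then show ?thesis by (simp add: coin_measure_def)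
qed

text \<open>Everything up to a fixed stage depends on a finite window of coins. Tracking this
  replaces measurability arguments: finite range, measurability and integrability all follow from
  it.\<close>

definition finitary :: "(('d::finite) config \<Rightarrow> 'a) \<Rightarrow> bool" where
  "finitary f \<longleftrightarrow> (\<exists>F. finite F \<and> (\<forall>\<gamma> \<gamma>'. (\<forall>x\<in>F. \<gamma> x = \<gamma>' x) \<longrightarrow> f \<gamma> = f \<gamma>'))"

lemma finitary_const [simp, intro]: "finitary (\<lambda>_. c)"
  unfolding finitary_def by blast

lemma finitary_coord [simp, intro]: "finitary (\<lambda>\<gamma>. \<gamma> x)"
  unfolding finitary_def by (rule exI[of _ "{x}"]) simp

lemma finitary_finite_range:
  assumes "finitary f"
  shows "finite (range f)"
proof -
  from assms obtain F where F: "finite F" "\<And>\<gamma> \<gamma>'. (\<forall>x\<in>F. \<gamma> x = \<gamma>' x) \<Longrightarrow> f \<gamma> = f \<gamma>'"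
    unfolding finitary_def by blast
  have "range f \<subseteq> (\<lambda>X. f (\<lambda>x. x \<in> X)) ` Pow F"
  proof
    fix y assume "y \<in> range f"
    then obtain \<gamma> where y: "y = f \<gamma>" by blast
    have "f \<gamma> = f (\<lambda>x. x \<in> {x\<in>F. \<gamma> x})" by (rule F(2)) simp
    then show "y \<in> (\<lambda>X. f (\<lambda>x. x \<in> X)) ` Pow F" unfolding y by (rule image_eqI) auto
  qed
  then show ?thesis using F(1) by (meson finite_Pow_iff finite_imageI finite_subset)
qed

text \<open>\<open>f\<close> takes finitely many values, so the windows of the relevant
  \<open>g y\<close> have a finite union. This covers evaluation at a random site, as in iterated
  hops.\<close>

lemma finitary_bind:
  assumes f: "finitary f" and g: "\<And>y. finitary (g y)"
  shows "finitary (\<lambda>\<gamma>. g (f \<gamma>) \<gamma>)"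
proof -
  from f obtain F where F: "finite F" "\<And>\<gamma> \<gamma>'. (\<forall>x\<in>F. \<gamma> x = \<gamma>' x) \<Longrightarrow> f \<gamma> = f \<gamma>'"
    unfolding finitary_def by blast
  from g obtain G where G: "\<And>y. finite (G y)" "\<And>y \<gamma> \<gamma>'. (\<forall>x\<in>G y. \<gamma> x = \<gamma>' x) \<Longrightarrow> g y \<gamma> = g y \<gamma>'"
    unfolding finitary_def by metis
  show ?thesis unfolding finitary_def
  proof (intro exI conjI allI impI)
    show "finite (F \<union> (\<Union>y\<in>range f. G y))" 
      using F(1) G(1) finitary_finite_range[OF f] by (intro finite_UnI finite_UN_I)
    fix \<gamma> \<gamma>' :: "'a config" assume "\<forall>x\<in>F \<union> (\<Union>y\<in>range f. G y). \<gamma> x = \<gamma>' x"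
    then show "g (f \<gamma>) \<gamma> = g (f \<gamma>') \<gamma>'" using F(2)[of \<gamma> \<gamma>'] G(2)[of "f \<gamma>" \<gamma> \<gamma>'] by auto
  qed
qed

lemma finitary_comp: "finitary f \<Longrightarrow> finitary (\<lambda>\<gamma>. h (f \<gamma>))"
  unfolding finitary_def by metis

lemma finitary_comp2: "finitary f \<Longrightarrow> finitary g \<Longrightarrow> finitary (\<lambda>\<gamma>. h (f \<gamma>) (g \<gamma>))"
  by (rule finitary_bind[where g="\<lambda>y \<gamma>. h y (g \<gamma>)"]) (auto intro: finitary_comp)

lemma finitary_Collect:
  assumes "finite A" "\<And>v. v \<in> A \<Longrightarrow> finitary (P v)"
  shows "finitary (\<lambda>\<gamma>. {v\<in>A. P v \<gamma>})"
  using assms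
proof (induction A rule: finite_induct)
  case (insert a A)
  have "finitary (\<lambda>\<gamma>. if P a \<gamma> then insert a {v\<in>A. P v \<gamma>} else {v\<in>A. P v \<gamma>})"
    by (rule finitary_comp2[where h="\<lambda>b X. if b then insert a X else X"]) (use insert in auto)
  moreover have "(\<lambda>\<gamma>. if P a \<gamma> then insert a {v\<in>A. P v \<gamma>} else {v\<in>A. P v \<gamma>}) = (\<lambda>\<gamma>. {v\<in>insert a A. P v \<gamma>})"
    by (rule ext) auto
  ultimately show ?case by simp
qed simp

lemma finitary_Ball:
  assumes "finite A" "\<And>v. v \<in> A \<Longrightarrow> finitary (P v)"
  shows "finitary (\<lambda>\<gamma>. \<forall>v\<in>A. P v \<gamma>)"
proof -
  have "finitary (\<lambda>\<gamma>. {v\<in>A. P v \<gamma>} = A)"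
    by (rule finitary_comp[where h="\<lambda>X. X = A"]) (rule finitary_Collect[OF assms])
  moreover have "(\<lambda>\<gamma>. {v\<in>A. P v \<gamma>} = A) = (\<lambda>\<gamma>. \<forall>v\<in>A. P v \<gamma>)" by auto
  ultimately show ?thesis by simp
qed

lemma finitary_sum:
  assumes "finite A" "\<And>v. v \<in> A \<Longrightarrow> finitary (f v)"
  shows "finitary (\<lambda>\<gamma>. \<Sum>v\<in>A. f v \<gamma>)"
  using assms by (induction A rule: finite_induct) (auto intro!: finitary_comp2[where h="(+)"])

text \<open>The function factors through the set of ones inside its window, and each value of that
  set is a cylinder event.\<close>

lemma finitary_measurable:
  assumes "finitary f" "\<And>\<gamma>. f \<gamma> \<in> space N"
  shows "f \<in> measurable coin_measure N"
proof -
  from assms obtain F where F: "finite F" "\<And>\<gamma> \<gamma>'. (\<forall>x\<in>F. \<gamma> x = \<gamma>' x) \<Longrightarrow> f \<gamma> = f \<gamma>'"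
    unfolding finitary_def by blast
  define S where "S \<gamma> = {x\<in>F. \<gamma> x}" for \<gamma>
  have eq: "f = (\<lambda>X. f (\<lambda>x. x \<in> X)) \<circ> S"
    by (rule ext, unfold o_apply, rule F(2)) (simp add: S_def)
  have S: "S \<in> measurable coin_measure (count_space (Pow F))"
  proof (rule measurable_count_space_eq2[THEN iffD2], use F in simp, intro conjI ballI)
    show "S \<in> space coin_measure \<rightarrow> Pow F" by (auto simp: S_def)
    fix X assume "X \<in> Pow F"
    then have "S \<gamma> = X \<longleftrightarrow> (\<forall>x\<in>F. \<gamma> x = (x \<in> X))" for \<gamma>
      unfolding S_def by blast
    then have "S -` {X} \<inter> space coin_measure = {\<gamma>. \<forall>x\<in>F. \<gamma> x \<in> {x \<in> X}}"
      by (simp add: vimage_def)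
    also have "\<dots> \<in> sets coin_measure"
      by (rule cylinder_sets[OF F(1)])
    finally show "S -` {X} \<inter> space coin_measure \<in> sets coin_measure" .
  qed
  show ?thesis
    by (subst eq, rule measurable_comp[OF S]) (use assms(2) in auto)
qed

lemma finitary_sets: "finitary P \<Longrightarrow> {\<gamma>. P \<gamma>} \<in> sets coin_measure"
  using measurable_sets[OF finitary_measurable[of P "count_space UNIV"], of "{True}"] by (simp add: vimage_def)

lemma finitary_integrable:
  fixes f :: "('d::finite) config \<Rightarrow> real"
  assumes "finitary f"
  shows "integrable coin_measure f"
proof -
  interpret prob_space "coin_measure :: 'd config measure" by (rule prob_space_coin)
  obtain B where B: "\<forall>y\<in>range f. norm y \<le> B"
    using finite_imp_bounded[OF finitary_finite_range[OF assms]] bounded_iff by blast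
  show ?thesis
    by (rule integrable_const_bound[where B=B]) (use B in \<open>auto intro!: finitary_measurable assms\<close>)
qed

lemma integral_reindex_flip:
  fixes f :: "('d::finite) config \<Rightarrow> real"
  assumes "inj \<pi>" "finitary f"
  shows "(\<integral>\<gamma>. f (\<lambda>x. \<gamma> (\<pi> x) \<noteq> (x \<in> S)) \<partial>coin_measure) = (\<integral>\<gamma>. f \<gamma> \<partial>coin_measure)"
proof -
  let ?T = "\<lambda>\<gamma> x. \<gamma> (\<pi> x) \<noteq> (x \<in> S)"
  have "?T \<in> measurable coin_measure (Pi\<^sub>M UNIV (\<lambda>_. measure_pmf (bernoulli_pmf (1/2))))"
    by (rule measurable_PiM_single') (auto intro!: measurable_compose[OF measurable_coord])
  then have T: "?T \<in> measurable coin_measure coin_measure" by (simp add: coin_measure_def)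
  have "(\<integral>\<gamma>. f \<gamma> \<partial>coin_measure) = (\<integral>\<gamma>. f \<gamma> \<partial>distr coin_measure coin_measure ?T)"
    using distr_coin_reindex_flip[OF assms(1)] by simp
  also have "\<dots> = (\<integral>\<gamma>. f (?T \<gamma>) \<partial>coin_measure)"
    by (rule integral_distr[OF T]) (intro finitary_measurable assms, simp)
  finally show ?thesis by simp
qed

lemma prob_eq_integral:
  "measure coin_measure {\<gamma>. Q \<gamma>} = (\<integral>\<gamma>. of_bool (Q \<gamma>) \<partial>coin_measure)"
proof -
  have "(\<lambda>\<gamma>. of_bool (Q \<gamma>)) = (indicator {\<gamma>. Q \<gamma>} :: _ \<Rightarrow> real)"
    by (auto simp: indicator_def fun_eq_iff)
  then show ?thesis by simp
qed

lemma prob_shift: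
  fixes P :: "('d::finite) config \<Rightarrow> bool"
  assumes "finitary P"
  shows "measure coin_measure {\<gamma>. P (config_shift z \<gamma>)} = measure coin_measure {\<gamma>. P \<gamma>}"
proof -
  have "(\<lambda>x. \<gamma> (x - z) \<noteq> (x \<in> {})) = config_shift z \<gamma>" for \<gamma> by (auto simp: config_shift_def)
  then show ?thesis
    using integral_reindex_flip[of "\<lambda>x. x - z" "\<lambda>\<gamma>. of_bool (P \<gamma>)" "{}"] assms
    by (simp add: prob_eq_integral inj_on_def finitary_comp)
qed

text \<open>Carrying along an extra cylinder event on \<open>G\<close> makes the induction on the set of blocks close
  without any appeal to independence.\<close>

lemma prob_avoid_blocks:
  fixes w :: "('d::finite) config" and B :: "'i \<Rightarrow> 'd site set"
  assumes "finite I" "finite G" "disjoint_family_on B I"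
    and "\<And>i. i \<in> I \<Longrightarrow> finite (B i) \<and> card (B i) = k \<and> B i \<inter> G = {}"
  shows "measure coin_measure {\<gamma>. (\<forall>x\<in>G. \<gamma> x = w x) \<and> (\<forall>i\<in>I. \<not> (\<forall>x\<in>B i. \<gamma> x = w x))}
       = (1/2) ^ card G * (1 - (1/2) ^ k) ^ card I"
  using assms
proof (induction I arbitrary: G rule: finite_induct)
  case empty
  have "(\<Prod>x\<in>G. ennreal (real (card {w x}) / 2)) = ennreal ((1/2) ^ card G)"
    by (subst prod_ennreal) auto
  then have "emeasure coin_measure {\<gamma>. \<forall>x\<in>G. \<gamma> x = w x} = ennreal ((1/2) ^ card G)"
    using emeasure_cylinder[of G "\<lambda>x. {w x}"] empty(1)
    by (simp only: singleton_iff)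
  then show ?case by (simp add: measure_def)
next
  case (insert a I)
  interpret prob_space "coin_measure :: 'd config measure" by (rule prob_space_coin)
  let ?E = "\<lambda>G. {\<gamma>. (\<forall>x\<in>G. \<gamma> x = w x) \<and> (\<forall>i\<in>I. \<not> (\<forall>x\<in>B i. \<gamma> x = w x))}"
  have a: "finite (B a)" "card (B a) = k" "B a \<inter> G = {}" using insert.prems(3) by auto
  have dis: "B i \<inter> B a = {}" if "i \<in> I" for i
    using insert.prems(2) insert.hyps(2) that by (auto simp: disjoint_family_on_def)
  have fd: "disjoint_family_on B I" using insert.prems(2) by (auto simp: disjoint_family_on_def)
  have 1: "measure coin_measure (?E G) = (1/2) ^ card G * (1 - (1/2) ^ k) ^ card I"
    by (rule insert.IH) (use insert.prems fd in auto)
  have "measure coin_measure (?E (G \<union> B a)) = (1/2) ^ card (G \<union> B a) * (1 - (1/2) ^ k) ^ card I"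
    by (rule insert.IH) (use insert.prems a dis fd in auto)
  then have 2: "measure coin_measure (?E (G \<union> B a)) = (1/2) ^ card G * (1/2) ^ k * (1 - (1/2) ^ k) ^ card I"
    using a insert.prems(1) by (subst (asm) card_Un_disjoint) (auto simp: power_add)
  have fin: "?E H \<in> sets coin_measure" if "finite H" for H
  proof (rule finitary_sets, rule finitary_comp2[where h="(\<and>)"])
    have eq: "finitary (\<lambda>\<gamma>. \<gamma> x = w x)" for x
      by (rule finitary_comp[where h="\<lambda>b. b = w x"]) (rule finitary_coord)
    show "finitary (\<lambda>\<gamma>. \<forall>x\<in>H. \<gamma> x = w x)" using that eq by (rule finitary_Ball)
    show "finitary (\<lambda>\<gamma>. \<forall>i\<in>I. \<not> (\<forall>x\<in>B i. \<gamma> x = w x))"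
      by (rule finitary_Ball[OF insert.hyps(1)], rule finitary_comp[where h=Not], rule finitary_Ball)
        (use insert.prems eq in auto)
  qed
  \<comment> \<open>Adding the block \<open>a\<close> removes the event in which \<open>a\<close>
    carries the word \<open>w\<close>; that event has the same form with \<open>G\<close> enlarged
    by \<open>B a\<close>.\<close>
  have split: "{\<gamma>. (\<forall>x\<in>G. \<gamma> x = w x) \<and> (\<forall>i\<in>insert a I. \<not> (\<forall>x\<in>B i. \<gamma> x = w x))} = ?E G - ?E (G \<union> B a)"
    by auto
  have 3: "measure coin_measure (?E G - ?E (G \<union> B a)) = measure coin_measure (?E G) - measure coin_measure (?E (G \<union> B a))"
  proof (rule finite_measure_Diff)
    show "?E G \<in> sets coin_measure" by (rule fin[OF insert.prems(1)])
    show "?E (G \<union> B a) \<in> sets coin_measure"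
      by (rule fin[OF finite_UnI[OF insert.prems(1) a(1)]])
    show "?E (G \<union> B a) \<subseteq> ?E G" by blast
  qed
  have 4: "u * v - u * q * v = u * ((1 - q) * v)" for u v q :: real
    by (simp add: algebra_simps)
  show ?case
    by (simp only: split 3 1 2 4 card_insert_disjoint[OF insert.hyps(1,2)] power_Suc)
qed

section \<open>Edges, cuts, seeds and nested cells\<close>

text \<open>The index \<open>undefined\<close> serves as an arbitrary but fixed coordinate direction.\<close>

definition along :: "int \<Rightarrow> ('d::finite) site" where
  "along j = axis undefined j"

lemma along_add: "along (i + j) = along i + along j"
  by (simp add: along_def axis_def vec_eq_iff)

lemma along_0 [simp]: "along 0 = 0"
  by (simp add: along_def axis_def vec_eq_iff)

lemma along_eq_iff [simp]: "along i = along j \<longleftrightarrow> i = j"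
  by (auto simp: along_def axis_eq_axis)

definition edge :: "('d::finite) config \<Rightarrow> 'd site \<Rightarrow> bool" where
  "edge \<gamma> x \<longleftrightarrow> \<gamma> x \<noteq> \<gamma> (x + along 1)"

text \<open>In terms of edges, a cut reads \<open>1 1 0 * 0\<close> with the cut itself at the star.  Two
  occurrences of this pattern never overlap in a way that involves a star, so the edge at a cut can be
  toggled freely.\<close>

definition cut_at :: "('d::finite) config \<Rightarrow> 'd site \<Rightarrow> bool" where
  "cut_at \<gamma> x \<longleftrightarrow> edge \<gamma> (x + along (-3)) \<and> edge \<gamma> (x + along (-2)) \<and>
     \<not> edge \<gamma> (x + along (-1)) \<and> \<not> edge \<gamma> (x + along 1)"

text \<open>Expressed through edges, seeds ignore a simultaneous flip of a whole line. The
  \<open>k\<close> edges span \<open>k + 1\<close> sites.\<close>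

definition seed :: "nat \<Rightarrow> ('d::finite) config \<Rightarrow> 'd site \<Rightarrow> bool" where
  "seed k \<gamma> x \<longleftrightarrow> (\<forall>i<k. edge \<gamma> (x + along (int i)))"

definition flip :: "('d::finite) site set \<Rightarrow> 'd config \<Rightarrow> 'd config" where
  "flip S \<gamma> = (\<lambda>x. \<gamma> x \<noteq> (x \<in> S))"

text \<open>A flip toggles exactly the edges on the boundary of \<open>S\<close>; the condition
  confines these to cuts.\<close>

definition flippable :: "('d::finite) config \<Rightarrow> 'd site set \<Rightarrow> bool" where
  "flippable \<gamma> S \<longleftrightarrow> (\<forall>x. (x \<in> S) \<noteq> (x + along 1 \<in> S) \<longrightarrow> cut_at \<gamma> x)"

lemma edge_flip: "edge (flip S \<gamma>) x = (edge \<gamma> x \<noteq> ((x \<in> S) \<noteq> (x + along 1 \<in> S)))"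
  by (auto simp: edge_def flip_def)

lemma cut_along:
  "cut_at \<gamma> (x + along i) \<longleftrightarrow> edge \<gamma> (x + along (i - 3)) \<and> edge \<gamma> (x + along (i - 2)) \<and>
     \<not> edge \<gamma> (x + along (i - 1)) \<and> \<not> edge \<gamma> (x + along (i + 1))"
proof -
  have "x + along (i + j) = x + along i + along j" for j by (simp add: along_add add.assoc)
  from this[of "-3"] this[of "-2"] this[of "-1"] this[of 1] show ?thesis by (simp add: cut_at_def add.assoc)
qed

text \<open>\<open>D\<close> and \<open>D'\<close> are the edges of a line before and after a flip.
  Adjacent edges are never both toggled: a cut at \<open>i\<close> needs \<open>i - 1\<close> off
  and \<open>i - 2\<close> on, whereas one at \<open>i + 1\<close> needs \<open>i - 1\<close> on and
  one at \<open>i - 1\<close> needs \<open>i - 2\<close> off. So the neighbours of \<open>i\<close>,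
  off before, stay off.\<close>

lemma toggle_neighbours:
  fixes D D' :: "int \<Rightarrow> bool"
  assumes "\<And>i. D i \<noteq> D' i \<Longrightarrow> D (i - 3) \<and> D (i - 2) \<and> \<not> D (i - 1) \<and> \<not> D (i + 1)"
    and "D i \<noteq> D' i"
  shows "\<not> D (i + 1)" "\<not> D' (i + 1)" "\<not> D (i - 1)" "\<not> D' (i - 1)" "D (i - 2)"
proof -
  have a: "i + 1 - 1 = i" "i + 1 - 2 = i - 1" "i - 1 + 1 = i" "i - 1 - 1 = i - 2" by auto
  note * = assms(1)[of i] assms(1)[of "i + 1", unfolded a] assms(1)[of "i - 1", unfolded a]
  show "\<not> D (i + 1)" "\<not> D' (i + 1)" "\<not> D (i - 1)" "\<not> D' (i - 1)" "D (i - 2)"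
    using * assms(2) by blast+
qed

text \<open>Once any of the four edges of the pattern is toggled, the pattern fails both before and
  after, because another of its edges has the wrong value in both sequences.\<close>

lemma toggle_pattern:
  fixes D D' :: "int \<Rightarrow> bool"
  assumes "\<And>i. D i \<noteq> D' i \<Longrightarrow> D (i - 3) \<and> D (i - 2) \<and> \<not> D (i - 1) \<and> \<not> D (i + 1)"
  shows "D' (i - 3) \<and> D' (i - 2) \<and> \<not> D' (i - 1) \<and> \<not> D' (i + 1) \<longleftrightarrow>
         D (i - 3) \<and> D (i - 2) \<and> \<not> D (i - 1) \<and> \<not> D (i + 1)"
proof (cases "D (i - 3) = D' (i - 3) \<and> D (i - 2) = D' (i - 2) \<and> D (i - 1) = D' (i - 1) \<and> D (i + 1) = D' (i + 1)")
  case False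
  note nb = toggle_neighbours[of D D', OF assms]
  have a: "i - 3 + 1 = i - 2" "i - 2 - 1 = i - 3" "i - 1 - 1 = i - 2" "i + 1 - 2 = i - 1" by auto
  from False consider "D (i - 3) \<noteq> D' (i - 3)" | "D (i - 2) \<noteq> D' (i - 2)" | "D (i - 1) \<noteq> D' (i - 1)"
    | "D (i + 1) \<noteq> D' (i + 1)" "D (i - 1) = D' (i - 1)" by blast
  then show ?thesis
  proof cases
    case 1 show ?thesis using nb[OF _ 1, unfolded a] by blast
  next
    case 2 show ?thesis using nb[OF _ 2, unfolded a] by blast
  next
    case 3 show ?thesis using nb[OF _ 3, unfolded a] by blast
  next
    \<comment> \<open>The edge \<open>i + 1\<close> has no neighbour in the pattern. The edge
      \<open>i - 1\<close>, two steps to its left, is on before the flip and, by the choice of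
      cases, also after it.\<close>
    case 4 show ?thesis using nb[OF _ 4(1), unfolded a] 4(2) by blast
  qed
qed blast

lemma edge_flip_cut:
  assumes "flippable \<gamma> S" "edge \<gamma> x \<noteq> edge (flip S \<gamma>) x"
  shows "cut_at \<gamma> x"
  using assms by (auto simp: flippable_def edge_flip)

lemma cut_flip:
  assumes "flippable \<gamma> S"
  shows "cut_at (flip S \<gamma>) x \<longleftrightarrow> cut_at \<gamma> x"
proof -
  have "edge \<gamma> (x + along (i - 3)) \<and> edge \<gamma> (x + along (i - 2)) \<and>
        \<not> edge \<gamma> (x + along (i - 1)) \<and> \<not> edge \<gamma> (x + along (i + 1))"
    if "edge \<gamma> (x + along i) \<noteq> edge (flip S \<gamma>) (x + along i)" for i
    using edge_flip_cut[OF assms that] unfolding cut_along .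
  from toggle_pattern[of "\<lambda>i. edge \<gamma> (x + along i)" "\<lambda>i. edge (flip S \<gamma>) (x + along i)" 0, OF this]
  show ?thesis using cut_along[of _ x 0] by simp
qed

text \<open>In a run of at least two edges every edge has a neighbour that is on, whereas both
  neighbours of a toggled edge are off before and after. So no edge of a run is toggled.\<close>

lemma seed_flip:
  assumes "flippable \<gamma> S" "2 \<le> k"
  shows "seed k (flip S \<gamma>) x \<longleftrightarrow> seed k \<gamma> x"
proof -
  define D where "D i = edge \<gamma> (x + along i)" for i
  define D' where "D' i = edge (flip S \<gamma>) (x + along i)" for i
  have *: "D i \<noteq> D' i \<Longrightarrow> D (i - 3) \<and> D (i - 2) \<and> \<not> D (i - 1) \<and> \<not> D (i + 1)" for i
    unfolding D_def D'_def by (drule edge_flip_cut[OF assms(1)]) (simp only: cut_along, blast)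
  have nb: "D i = D' i" if "D (i + 1) \<or> D' (i + 1) \<or> D (i - 1) \<or> D' (i - 1)" for i
    using toggle_neighbours[of D D' i, OF *] that by blast
  \<comment> \<open>\<open>X\<close> stands for whichever edge sequence carries the run, so both
    directions follow at once. The last edge uses its left neighbour, every other edge its right
    one.\<close>
  have eq: "D i = D' i" if "\<forall>i<k. X (int i)" "0 \<le> i" "i < int k" "\<And>j. X j \<Longrightarrow> D j \<or> D' j" for i X
  proof (cases "i + 1 < int k")
    case True
    then have "X (i + 1)" using that(1)[rule_format, of "nat (i + 1)"] that(2) by auto
    then show ?thesis using nb[of i] that(4) by blast
  next
    case False
    then have "X (i - 1)" using that(1)[rule_format, of "nat (i - 1)"] that(2,3) assms(2) by auto
    then show ?thesis using nb[of i] that(4) by blast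
  qed
  have "(\<forall>i<k. D' (int i)) \<longleftrightarrow> (\<forall>i<k. D (int i))"
    using eq[of D] eq[of D'] by auto
  then show ?thesis by (simp add: seed_def D_def D'_def)
qed

section \<open>Hops to nearby seeds, translations and nested centres\<close>

definition sball :: "nat \<Rightarrow> ('d::finite) site set" where
  "sball b = {v. linf_norm v \<le> int b}"

lemma linf_norm_le_iff: "linf_norm (v :: ('d::finite) site) \<le> B \<longleftrightarrow> (\<forall>i. \<bar>v $ i\<bar> \<le> B)"
  unfolding linf_norm_def by (subst Max_le_iff) auto

lemma finite_sball [simp]: "finite (sball b :: ('d::finite) site set)"
proof -
  have "(sball b :: 'd site set) \<subseteq> vec_lambda ` (PiE UNIV (\<lambda>_. {- int b..int b}))"
  proof
    fix v :: "'d site" assume "v \<in> sball b"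
    then have "vec_nth v \<in> PiE UNIV (\<lambda>_. {- int b..int b})"
      by (auto simp: sball_def linf_norm_le_iff abs_le_iff minus_le_iff)
    then show "v \<in> vec_lambda ` (PiE UNIV (\<lambda>_. {- int b..int b}))"
      by (intro image_eqI[where x="vec_nth v"]) simp_all
  qed
  then show ?thesis by (rule finite_subset) (intro finite_imageI finite_PiE, auto)
qed

lemma sball_add: "v \<in> sball a \<Longrightarrow> w \<in> sball b \<Longrightarrow> v + w \<in> sball (a + b)"
  by (auto simp: sball_def linf_norm_le_iff intro!: order_trans[OF abs_triangle_ineq] add_mono)

lemma sball_minus [simp]: "- v \<in> sball a \<longleftrightarrow> v \<in> sball a"
  by (simp add: sball_def linf_norm_le_iff)

lemma sball_0 [simp]: "0 \<in> sball a"
  by (simp add: sball_def linf_norm_le_iff)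

text \<open>The choice is made among offsets \<open>v\<close>, not among target sites, so that it
  commutes with translations.\<close>

definition hop :: "nat \<Rightarrow> nat \<Rightarrow> ('d::finite) config \<Rightarrow> 'd site \<Rightarrow> 'd site" where
  "hop k b \<gamma> y = (if \<exists>v\<in>sball b. seed k \<gamma> (y + v)
     then y + (SOME v. v \<in> sball b \<and> seed k \<gamma> (y + v)) else y)"

lemma hop_seed:
  assumes "v \<in> sball b" "seed k \<gamma> (y + v)"
  shows "hop k b \<gamma> y - y \<in> sball b" "seed k \<gamma> (hop k b \<gamma> y)"
  using someI[of "\<lambda>v. v \<in> sball b \<and> seed k \<gamma> (y + v)", OF conjI[OF assms]] assms
  by (auto simp: hop_def)

lemma hop_reach: "hop k b \<gamma> y - y \<in> sball b"
proof (cases "\<exists>v\<in>sball b. seed k \<gamma> (y + v)")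
  case True then show ?thesis using hop_seed(1) by blast
qed (simp add: hop_def)

lemma config_shift_apply [simp]: "config_shift z \<gamma> (x + z) = \<gamma> x"
  by (simp add: config_shift_def)

lemma edge_shift: "edge (config_shift z \<gamma>) (x + z) = edge \<gamma> x"
proof -
  have "x + z + along 1 = (x + along 1) + z" by (simp add: algebra_simps)
  then show ?thesis by (simp only: edge_def config_shift_apply)
qed

lemma edge_shift': "edge (config_shift z \<gamma>) (x + z + y) = edge \<gamma> (x + y)"
  using edge_shift[of z \<gamma> "x + y"] by (simp add: algebra_simps)

lemma cut_shift: "cut_at (config_shift z \<gamma>) (x + z) = cut_at \<gamma> x"
  by (simp only: cut_at_def edge_shift')

lemma seed_shift: "seed k (config_shift z \<gamma>) (x + z) = seed k \<gamma> x"
  by (simp only: seed_def edge_shift')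

lemma hop_shift: "hop k b (config_shift z \<gamma>) (y + z) = hop k b \<gamma> y + z"
proof -
  have "seed k (config_shift z \<gamma>) (y + z + v) = seed k \<gamma> (y + v)" for v
    using seed_shift[of k z \<gamma> "y + v"] by (simp add: algebra_simps)
  then show ?thesis by (simp add: hop_def)
qed

lemma finitary_edge: "finitary (\<lambda>\<gamma>. edge \<gamma> x)"
  unfolding edge_def by (rule finitary_comp2) auto

lemma finitary_cut: "finitary (\<lambda>\<gamma>. cut_at \<gamma> x)"
  unfolding cut_at_def
  by (intro finitary_comp2[where h="(\<and>)"] finitary_comp[where h=Not] finitary_edge)

lemma finitary_seed: "finitary (\<lambda>\<gamma>. seed k \<gamma> x)"
proof -
  have "finitary (\<lambda>\<gamma>. \<forall>i\<in>{..<k}. edge \<gamma> (x + along (int i)))"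
    by (rule finitary_Ball) (auto intro: finitary_edge)
  then show ?thesis by (simp add: seed_def lessThan_def)
qed

lemma finitary_hop: "finitary (\<lambda>\<gamma>. hop k b \<gamma> y)"
proof -
  let ?h = "\<lambda>V. if V \<noteq> {} then y + (SOME v. v \<in> V) else y"
  have "finitary (\<lambda>\<gamma>. ?h {v\<in>sball b. seed k \<gamma> (y + v)})"
    by (rule finitary_comp[where h="?h"]) (intro finitary_Collect finitary_seed finite_sball)
  moreover have "(\<lambda>\<gamma>. ?h {v\<in>sball b. seed k \<gamma> (y + v)}) = (\<lambda>\<gamma>. hop k b \<gamma> y)"
    by (rule ext) (auto simp: hop_def)
  ultimately show ?thesis by simp
qed

text \<open>Edge \<open>i\<close> joins the sites \<open>i\<close> and \<open>i + 1\<close> of the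
  line, so the range lists the edges between \<open>x\<close> and \<open>x + along j\<close> for
  either sign of \<open>j\<close>.\<close>

definition uncut :: "('d::finite) config \<Rightarrow> 'd site \<Rightarrow> int \<Rightarrow> bool" where
  "uncut \<gamma> x j \<longleftrightarrow> (\<forall>i\<in>{min 0 j..<max 0 j}. \<not> cut_at \<gamma> (x + along i))"

lemma uncut_shift: "uncut (config_shift z \<gamma>) (x + z) j = uncut \<gamma> x j"
proof -
  have "cut_at (config_shift z \<gamma>) (x + z + y) = cut_at \<gamma> (x + y)" for y
    using cut_shift[of z \<gamma> "x + y"] by (simp add: algebra_simps)
  then show ?thesis by (simp add: uncut_def)
qed

lemma finitary_uncut: "finitary (\<lambda>\<gamma>. uncut \<gamma> x j)"
  unfolding uncut_def by (rule finitary_Ball) (auto intro: finitary_comp finitary_cut)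

text \<open>\<open>k n\<close> and \<open>b n\<close> are the seed length and hop radius for passing
  from level \<open>n\<close> to level \<open>n + 1\<close>. The bound on \<open>k\<close> is the
  one \<open>seed_flip\<close> demands.\<close>

locale hierarchy =
  fixes k b :: "nat \<Rightarrow> nat"
  assumes k_ge_2: "2 \<le> k n"
begin

text \<open>The level-\<open>n\<close> cells are the fibres of \<open>ctr n\<close>. For a given
  \<open>\<gamma>\<close> each centre is a function of the previous one, which makes the cells
  nested.\<close>

primrec ctr :: "nat \<Rightarrow> ('d::finite) config \<Rightarrow> 'd site \<Rightarrow> 'd site" where
  "ctr 0 \<gamma> x = x"
| "ctr (Suc n) \<gamma> x = hop (k n) (b n) \<gamma> (ctr n \<gamma> x)"

definition reach :: "nat \<Rightarrow> nat" where
  "reach n = (\<Sum>i<n. b i)"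

lemma ctr_reach: "ctr n \<gamma> x - x \<in> sball (reach n)"
proof (induction n)
  case (Suc n)
  have "ctr (Suc n) \<gamma> x - x = (ctr n \<gamma> x - x) + (hop (k n) (b n) \<gamma> (ctr n \<gamma> x) - ctr n \<gamma> x)" by simp
  also have "\<dots> \<in> sball (reach n + b n)" by (rule sball_add[OF Suc hop_reach])
  finally show ?case by (simp add: reach_def)
qed simp

lemma ctr_shift: "ctr n (config_shift z \<gamma>) (x + z) = ctr n \<gamma> x + z"
  by (induction n) (simp_all add: hop_shift)

text \<open>Hops depend on the coins only through seeds, which such flips preserve.\<close>

lemma ctr_flip: "flippable \<gamma> S \<Longrightarrow> ctr n (flip S \<gamma>) x = ctr n \<gamma> x"
  by (induction n) (simp_all add: hop_def seed_flip k_ge_2)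

lemma finitary_ctr: "finitary (\<lambda>\<gamma>. ctr n \<gamma> x)"
  by (induction n) (auto intro: finitary_bind[where g="\<lambda>y \<gamma>. hop (k n) (b n) \<gamma> y" for n] finitary_hop)

end

section \<open>Matching in stages\<close>

text \<open>The final clause is maximality: fixed points cannot remain on both sides, so
  \<open>H\<close> or \<open>T\<close> is used up.\<close>

definition pairing :: "'a set \<Rightarrow> 'a set \<Rightarrow> ('a \<Rightarrow> 'a) \<Rightarrow> bool" where
  "pairing H T f \<longleftrightarrow> (\<forall>x. f (f x) = x) \<and>
     (\<forall>x. f x \<noteq> x \<longrightarrow> x \<in> H \<and> f x \<in> T \<or> x \<in> T \<and> f x \<in> H) \<and>
     (\<forall>x\<in>H. \<forall>y\<in>T. f x \<noteq> x \<or> f y \<noteq> y)"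

text \<open>Pairing \<open>min (card H) (card T)\<close> elements of each side exhausts the smaller
  one.\<close>

lemma pairing_exists:
  assumes "finite H" "finite T" "H \<inter> T = {}"
  shows "\<exists>f. pairing H T f"
proof -
  define n where "n = min (card H) (card T)"
  have "n \<le> card H" by (simp add: n_def)
  then obtain H' where H': "H' \<subseteq> H" "card H' = n" by (meson obtain_subset_with_card_n)
  have "n \<le> card T" by (simp add: n_def)
  then obtain T' where T': "T' \<subseteq> T" "card T' = n" by (meson obtain_subset_with_card_n)
  have fin: "finite H'" "finite T'" using H' T' assms finite_subset by blast+
  obtain g where g: "bij_betw g H' T'" using finite_same_card_bij[OF fin] H' T' by auto
  define f where "f x = (if x \<in> H' then g x else if x \<in> T' then inv_into H' g x else x)" for x
  have dis: "H' \<inter> T' = {}" using H' T' assms by blast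
  have gT: "g x \<in> T'" if "x \<in> H'" for x using g that by (auto simp: bij_betw_def)
  have gH: "inv_into H' g x \<in> H'" if "x \<in> T'" for x using g that by (auto simp: bij_betw_def inv_into_into)
  have "f (f x) = x" for x
    using dis gT gH bij_betw_inv_into_left[OF g] bij_betw_inv_into_right[OF g] by (auto simp: f_def)
  moreover have "x \<in> H \<and> f x \<in> T \<or> x \<in> T \<and> f x \<in> H" if "f x \<noteq> x" for x
    using that H'(1) T'(1) gT gH by (auto simp: f_def split: if_splits)
  moreover have "f x \<noteq> x \<or> f y \<noteq> y" if "x \<in> H" "y \<in> T" for x y
  proof -
    have "H' = H \<or> T' = T"
      using H' T' assms(1,2) by (auto simp: n_def min_def card_subset_eq split: if_splits)
    moreover have "f x \<noteq> x" if "x \<in> H'" for x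
      using that gT[OF that] dis unfolding f_def by (metis disjoint_iff)
    moreover have "f y \<noteq> y" if "y \<in> T'" for y
      using that gH[OF that] dis unfolding f_def by (metis disjoint_iff)
    ultimately show ?thesis using that by blast
  qed
  ultimately have "pairing H T f" unfolding pairing_def by blast
  then show ?thesis by blast
qed

text \<open>Leftover sets are recorded as offsets from the cell centre \<open>a\<close>, so that the choice of a
  pairing commutes with translations.\<close>

definition leftover :: "(('d::finite) site \<Rightarrow> 'd site) \<Rightarrow> ('d site \<Rightarrow> 'd site) \<Rightarrow> 'd config \<Rightarrow> 'd site \<Rightarrow> bool \<Rightarrow> 'd site set" where
  "leftover c m \<gamma> a t = {v. c (a + v) = a \<and> m (a + v) = a + v \<and> \<gamma> (a + v) = t}"

text \<open>Being unmatched is encoded as being a fixed point; partners found earlier are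
  kept.\<close>

definition pair_step :: "(('d::finite) site \<Rightarrow> 'd site) \<Rightarrow> ('d site \<Rightarrow> 'd site) \<Rightarrow> 'd config \<Rightarrow> 'd site \<Rightarrow> 'd site" where
  "pair_step c m \<gamma> x = (if m x \<noteq> x then m x else
     c x + (SOME f. pairing (leftover c m \<gamma> (c x) True) (leftover c m \<gamma> (c x) False) f) (x - c x))"

definition partial_matching :: "(('d::finite) site \<Rightarrow> 'd site) \<Rightarrow> 'd config \<Rightarrow> ('d site \<Rightarrow> 'd site) \<Rightarrow> bool" where
  "partial_matching c \<gamma> m \<longleftrightarrow>
     (\<forall>x. m (m x) = x \<and> (m x \<noteq> x \<longrightarrow> \<gamma> (m x) = (\<not> \<gamma> x)) \<and> c (m x) = c x)"

text \<open>Two unmatched sites of one cell with different coins would be fixed points of the chosen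
  pairing on both sides, against its maximality. Finiteness of the cells ensures that a pairing
  exists.\<close>

lemma pair_step:
  assumes m: "partial_matching c \<gamma> m" and fin: "\<And>a. finite {x. c x = a}"
  shows "partial_matching c \<gamma> (pair_step c m \<gamma>)"
    and "\<lbrakk>pair_step c m \<gamma> x = x; pair_step c m \<gamma> y = y; c x = c y\<rbrakk> \<Longrightarrow> \<gamma> x = \<gamma> y"
proof -
  define F where "F a = (SOME f. pairing (leftover c m \<gamma> a True) (leftover c m \<gamma> a False) f)" for a
  have F: "pairing (leftover c m \<gamma> a True) (leftover c m \<gamma> a False) (F a)" for a
    unfolding F_def
  proof (rule someI_ex[of "pairing _ _"], rule pairing_exists)
    have "finite ((\<lambda>v. a + v) -` {x. c x = a})" by (rule finite_vimageI[OF fin]) (simp add: inj_on_def)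
    then have "finite (leftover c m \<gamma> a t)" for t
      by (rule rev_finite_subset) (auto simp: leftover_def)
    then show "finite (leftover c m \<gamma> a True)" "finite (leftover c m \<gamma> a False)" by blast+
    show "leftover c m \<gamma> a True \<inter> leftover c m \<gamma> a False = {}" by (auto simp: leftover_def)
  qed
  have inv: "F a (F a v) = v" for a v using F[of a] by (simp add: pairing_def)
  have mem: "c (a + F a v) = a \<and> m (a + F a v) = a + F a v \<and> \<gamma> (a + F a v) = (\<not> \<gamma> (a + v))"
    if "F a v \<noteq> v" for a v
    using F[of a] that by (auto simp: pairing_def leftover_def)
  have step: "pair_step c m \<gamma> x = (if m x \<noteq> x then m x else c x + F (c x) (x - c x))" for x
    by (simp add: pair_step_def F_def)
  have mm: "m (m x) = x" "m x \<noteq> x \<Longrightarrow> \<gamma> (m x) = (\<not> \<gamma> x)" "c (m x) = c x" for x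
    using m by (auto simp: partial_matching_def)
  show "partial_matching c \<gamma> (pair_step c m \<gamma>)"
    unfolding partial_matching_def
  proof (intro allI)
    fix x
    let ?y = "pair_step c m \<gamma> x"
    show "pair_step c m \<gamma> ?y = x \<and> (?y \<noteq> x \<longrightarrow> \<gamma> ?y = (\<not> \<gamma> x)) \<and> c ?y = c x"
    proof (cases "m x = x")
      case False
      then show ?thesis using mm[of x] by (auto simp: step)
    next
      case True
      then have y: "?y = c x + F (c x) (x - c x)" by (simp add: step)
      show ?thesis
      proof (cases "F (c x) (x - c x) = x - c x")
        case True
        then have "?y = x" using y by simp
        then show ?thesis by simp
      next
        case False
        note mem = mem[OF False, folded y]
        have "pair_step c m \<gamma> ?y = c x + F (c x) (?y - c x)" using mem by (simp add: step[of ?y])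
        also have "?y - c x = F (c x) (x - c x)" using y by simp
        finally show ?thesis using mem by (simp add: inv)
      qed
    qed
  qed
  assume fixed: "pair_step c m \<gamma> x = x" "pair_step c m \<gamma> y = y" and cxy: "c x = c y"
  have mx: "m z = z" if "pair_step c m \<gamma> z = z" for z using that by (auto simp: step split: if_splits)
  have fz: "F (c z) (z - c z) = z - c z" if "pair_step c m \<gamma> z = z" for z
    using that mx[OF that] by (simp add: step) (metis add_diff_cancel_left')
  show "\<gamma> x = \<gamma> y"
  proof (rule ccontr)
    assume ne: "\<gamma> x \<noteq> \<gamma> y"
    have "z - c x \<in> leftover c m \<gamma> (c x) (\<gamma> z)" if "z = x \<or> z = y" for z
      using that mx fixed cxy by (auto simp: leftover_def)
    then have "x - c x \<in> leftover c m \<gamma> (c x) (\<gamma> x)" "y - c x \<in> leftover c m \<gamma> (c x) (\<gamma> y)" by blast+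
    moreover have "F (c x) (x - c x) = x - c x" "F (c x) (y - c x) = y - c x"
      using fz[OF fixed(1)] fz[OF fixed(2)] by (simp_all add: cxy)
    moreover have "F (c x) u \<noteq> u \<or> F (c x) w \<noteq> w"
      if "u \<in> leftover c m \<gamma> (c x) True" "w \<in> leftover c m \<gamma> (c x) False" for u w
      using F[of "c x"] that unfolding pairing_def by blast
    ultimately show False using ne by (metis (full_types))
  qed
qed

definition coin_sign :: "bool \<Rightarrow> real" where
  "coin_sign t = (if t then 1 else - 1)"

text \<open>Matched pairs cancel in the sum of signs, and the fixed points all carry the same
  sign.\<close>

lemma card_fixed_points:
  assumes "partial_matching c \<gamma> m" "finite A" "m ` A \<subseteq> A"
    and same: "\<And>x y. \<lbrakk>x \<in> A; y \<in> A; m x = x; m y = y\<rbrakk> \<Longrightarrow> \<gamma> x = \<gamma> y"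
  shows "real (card {x\<in>A. m x = x}) = \<bar>\<Sum>x\<in>A. coin_sign (\<gamma> x)\<bar>"
proof -
  have mm: "m (m x) = x" "m x \<noteq> x \<Longrightarrow> \<gamma> (m x) = (\<not> \<gamma> x)" for x
    using assms(1) by (auto simp: partial_matching_def)
  let ?N = "{x\<in>A. m x \<noteq> x}" and ?F = "{x\<in>A. m x = x}"
  have "(\<Sum>x\<in>?N. coin_sign (\<gamma> x)) = (\<Sum>x\<in>?N. coin_sign (\<gamma> (m x)))"
    by (rule sum.reindex_bij_witness[of _ m m]) (use mm assms(3) in auto)
  also have "\<dots> = (\<Sum>x\<in>?N. - coin_sign (\<gamma> x))"
    by (rule sum.cong) (use mm in \<open>auto simp: coin_sign_def\<close>)
  finally have N: "(\<Sum>x\<in>?N. coin_sign (\<gamma> x)) = 0" by (simp add: sum_negf)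
  have "(\<Sum>x\<in>A. coin_sign (\<gamma> x)) = (\<Sum>x\<in>?F \<union> ?N. coin_sign (\<gamma> x))"
    by (rule sum.cong) auto
  also have "\<dots> = (\<Sum>x\<in>?F. coin_sign (\<gamma> x)) + (\<Sum>x\<in>?N. coin_sign (\<gamma> x))"
    by (rule sum.union_disjoint) (use assms(2) in auto)
  finally have S: "(\<Sum>x\<in>A. coin_sign (\<gamma> x)) = (\<Sum>x\<in>?F. coin_sign (\<gamma> x))" using N by simp
  show ?thesis
  proof (cases "?F = {}")
    case True
    then show ?thesis by (simp only: S) simp
  next
    case False
    then obtain y where y: "y \<in> ?F" by blast
    have "(\<Sum>x\<in>?F. coin_sign (\<gamma> x)) = (\<Sum>x\<in>?F. coin_sign (\<gamma> y))"
    proof (rule sum.cong[OF refl])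
      fix x assume "x \<in> ?F"
      then have "\<gamma> x = \<gamma> y" using same[of x y] y by blast
      then show "coin_sign (\<gamma> x) = coin_sign (\<gamma> y)" by simp
    qed
    also have "\<dots> = real (card ?F) * coin_sign (\<gamma> y)" by simp
    finally show ?thesis by (simp only: S) (simp add: coin_sign_def abs_mult)
  qed
qed

lemma pair_step_shift:
  assumes "\<And>x. c' (x + z) = c x + z" "\<And>x. m' (x + z) = m x + z"
  shows "pair_step c' m' (config_shift z \<gamma>) (x + z) = pair_step c m \<gamma> x + z"
proof -
  have "leftover c' m' (config_shift z \<gamma>) (a + z) t = leftover c m \<gamma> a t" for a t
  proof -
    have "a + z + v = (a + v) + z" for v by (simp add: algebra_simps)
    then show ?thesis unfolding leftover_def by (simp only: assms config_shift_apply add_right_cancel)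
  qed
  then show ?thesis by (simp add: pair_step_def assms)
qed

section \<open>Stages over the nested cells and their limit\<close>

context hierarchy
begin

primrec stage :: "nat \<Rightarrow> ('d::finite) config \<Rightarrow> 'd site \<Rightarrow> 'd site" where
  "stage 0 \<gamma> = (\<lambda>x. x)"
| "stage (Suc n) \<gamma> = pair_step (ctr (Suc n) \<gamma>) (stage n \<gamma>) \<gamma>"

lemma ctr_in_sball: "ctr n \<gamma> (a + v) = a \<Longrightarrow> v \<in> sball (reach n)"
  using ctr_reach[of n \<gamma> "a + v"] by simp

lemma finite_cell: "finite {x. ctr n \<gamma> x = a}"
proof (rule finite_subset)
  show "{x. ctr n \<gamma> x = a} \<subseteq> (\<lambda>v. a + v) ` sball (reach n)"
  proof
    fix x assume "x \<in> {x. ctr n \<gamma> x = a}"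
    then have "x - a \<in> sball (reach n)" using ctr_in_sball[of n \<gamma> a "x - a"] by simp
    then show "x \<in> (\<lambda>v. a + v) ` sball (reach n)" by (rule rev_image_eqI) simp
  qed
qed simp

lemma partial_matching_stage: "partial_matching (ctr n \<gamma>) \<gamma> (stage n \<gamma>)"
proof (induction n)
  case (Suc n)
  \<comment> \<open>Nestedness: sites with the same centre at level \<open>n\<close> keep a common
    centre at level \<open>Suc n\<close>.\<close>
  then have "partial_matching (ctr (Suc n) \<gamma>) \<gamma> (stage n \<gamma>)"
    by (auto simp: partial_matching_def)
  then show ?case by (simp only: stage.simps pair_step(1)[OF _ finite_cell])
qed (simp add: partial_matching_def)

text \<open>The last pairing step saturates the cells of its own level; at level 0 every cell is a
  single site.\<close>

lemma stage_saturated: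
  "\<lbrakk>stage n \<gamma> x = x; stage n \<gamma> y = y; ctr n \<gamma> x = ctr n \<gamma> y\<rbrakk> \<Longrightarrow> \<gamma> x = \<gamma> y"
proof (cases n)
  case (Suc n')
  have "partial_matching (ctr (Suc n') \<gamma>) \<gamma> (stage n' \<gamma>)"
    using partial_matching_stage[of n' \<gamma>] by (auto simp: partial_matching_def)
  moreover assume "stage n \<gamma> x = x" "stage n \<gamma> y = y" "ctr n \<gamma> x = ctr n \<gamma> y"
  ultimately show ?thesis
    unfolding Suc stage.simps by (rule pair_step(2)[OF _ finite_cell])
qed simp

lemma stage_Suc: "stage n \<gamma> x \<noteq> x \<Longrightarrow> stage (Suc n) \<gamma> x = stage n \<gamma> x"
  by (simp add: pair_step_def)

lemma stage_mono:
  assumes "stage n \<gamma> x \<noteq> x" "n \<le> n'"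
  shows "stage n' \<gamma> x = stage n \<gamma> x"
  using assms(2)
proof (induction n' rule: dec_induct)
  case (step j)
  then have "stage j \<gamma> x \<noteq> x" using assms(1) by simp
  then show ?case using step.IH stage_Suc by metis
qed simp

lemma stage_shift: "stage n (config_shift z \<gamma>) (x + z) = stage n \<gamma> x + z"
proof (induction n arbitrary: x)
  case (Suc n)
  show ?case unfolding stage.simps by (rule pair_step_shift) (rule ctr_shift, rule Suc)
qed simp

lemma finitary_stage: "finitary (\<lambda>\<gamma>. stage n \<gamma> x)"
proof (induction n arbitrary: x)
  case (Suc n)
  define L where "L a \<gamma> t = leftover (ctr (Suc n) \<gamma>) (stage n \<gamma>) \<gamma> a t" for a :: "'a site" and \<gamma> t
  have "finitary (\<lambda>\<gamma>. {v\<in>sball (reach (Suc n)). ctr (Suc n) \<gamma> (a + v) = a \<and> stage n \<gamma> (a + v) = a + v \<and> \<gamma> (a + v) = t})"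
    for a :: "'a site" and t
    by (rule finitary_Collect[OF finite_sball], rule finitary_comp2[where h="(\<and>)"], rule finitary_comp[OF finitary_ctr],
      rule finitary_comp2[where h="(\<and>)"], rule finitary_comp[OF Suc], rule finitary_comp[OF finitary_coord])
  moreover have "{v\<in>sball (reach (Suc n)). ctr (Suc n) \<gamma> (a + v) = a \<and> stage n \<gamma> (a + v) = a + v \<and> \<gamma> (a + v) = t} = L a \<gamma> t"
    for a t \<gamma>
    using ctr_in_sball[of "Suc n" \<gamma> a] unfolding L_def leftover_def by blast
  ultimately have L: "finitary (\<lambda>\<gamma>. L a \<gamma> t)" for a t by simp
  \<comment> \<open>The centre \<open>a\<close> is held fixed here; the random centre is put in
    afterwards by \<open>finitary_bind\<close>.\<close>
  have "finitary (\<lambda>\<gamma>. if stage n \<gamma> x \<noteq> x then stage n \<gamma> x else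
     a + (SOME f. pairing (fst (L a \<gamma> True, L a \<gamma> False)) (snd (L a \<gamma> True, L a \<gamma> False)) f) (x - a))" for a
    by (rule finitary_comp2[OF Suc finitary_comp2[OF L L, where h=Pair],
      where h="\<lambda>y P. if y \<noteq> x then y else a + (SOME f. pairing (fst P) (snd P) f) (x - a)"])
  from finitary_bind[OF finitary_ctr[of "Suc n" x] this]
  show ?case by (simp only: stage.simps pair_step_def[abs_def] L_def fst_conv snd_conv)
qed simp

text \<open>For a site that is never matched the \<open>LEAST\<close> is unspecified, but every
  stage fixes the site, so the value is the site itself.\<close>

definition limit_stage :: "('d::finite) config \<Rightarrow> 'd site \<Rightarrow> 'd site" where
  "limit_stage \<gamma> x = stage (LEAST n. stage n \<gamma> x \<noteq> x) \<gamma> x"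

lemma limit_stage_eq: "stage n \<gamma> x \<noteq> x \<Longrightarrow> limit_stage \<gamma> x = stage n \<gamma> x"
  unfolding limit_stage_def by (rule stage_mono[symmetric]) (erule LeastI, erule Least_le)

lemma limit_stage_shift: "limit_stage (config_shift z \<gamma>) (x + z) = limit_stage \<gamma> x + z"
  by (simp add: limit_stage_def stage_shift)

text \<open>Partners share a centre and each lies within \<open>reach n\<close> of it.\<close>

lemma stage_reach: "stage n \<gamma> x - x \<in> sball (2 * reach n)"
proof -
  have "ctr n \<gamma> (stage n \<gamma> x) = ctr n \<gamma> x"
    using partial_matching_stage[of n \<gamma>] by (auto simp: partial_matching_def)
  then have "stage n \<gamma> x - ctr n \<gamma> x \<in> sball (reach n)"
    using ctr_in_sball[of n \<gamma> "ctr n \<gamma> x" "stage n \<gamma> x - ctr n \<gamma> x"] by simp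
  from sball_add[OF this ctr_reach[of n \<gamma> x]] show ?thesis by (simp add: mult_2)
qed

lemma matching_on_limit_stage:
  assumes "\<And>x. \<exists>n. stage n \<gamma> x \<noteq> x"
  shows "matching_on \<gamma> (limit_stage \<gamma>)"
proof -
  have *: "limit_stage \<gamma> (limit_stage \<gamma> x) = x \<and> \<gamma> (limit_stage \<gamma> x) = (\<not> \<gamma> x)" for x
  proof -
    obtain n where n: "stage n \<gamma> x \<noteq> x" using assms by blast
    have "stage n \<gamma> (stage n \<gamma> x) = x" "\<gamma> (stage n \<gamma> x) = (\<not> \<gamma> x)"
      using partial_matching_stage[of n \<gamma>] n by (auto simp: partial_matching_def)
    \<comment> \<open>Stage \<open>n\<close> moves the partner as well, so the limit is read off at
      stage \<open>n\<close> for both sites.\<close>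
    then show ?thesis using limit_stage_eq[OF n] limit_stage_eq[of n \<gamma> "stage n \<gamma> x"] n by metis
  qed
  then have "limit_stage \<gamma> \<circ> limit_stage \<gamma> = id" by auto
  then show ?thesis using * by (auto simp: matching_on_def intro: o_bij)
qed

lemma measurable_limit_stage:
  "case_prod (limit_stage :: ('d::finite) config \<Rightarrow> _) \<in> coin_measure \<Otimes>\<^sub>M count_space UNIV \<rightarrow>\<^sub>M count_space UNIV"
proof -
  have r: "(\<lambda>\<gamma>. limit_stage \<gamma> x) \<in> coin_measure \<rightarrow>\<^sub>M count_space UNIV" for x :: "'d site"
    unfolding limit_stage_def
  proof (rule measurable_compose_countable[where f="\<lambda>n \<gamma>. stage n \<gamma> x" and g="\<lambda>\<gamma>. LEAST n. stage n \<gamma> x \<noteq> x"])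
    show "(\<lambda>\<gamma>. stage n \<gamma> x) \<in> coin_measure \<rightarrow>\<^sub>M count_space UNIV" for n
      by (rule finitary_measurable[OF finitary_stage]) simp
    show "(\<lambda>\<gamma>. LEAST n. stage n \<gamma> x \<noteq> x) \<in> coin_measure \<rightarrow>\<^sub>M count_space UNIV"
      by (rule measurable_Least) (rule finitary_measurable[OF finitary_comp[OF finitary_stage]], simp)
  qed
  have "(\<lambda>p. (\<lambda>x p. limit_stage (fst p) x) (snd p) p) \<in> coin_measure \<Otimes>\<^sub>M count_space UNIV \<rightarrow>\<^sub>M count_space (UNIV :: 'd site set)"
    by (rule measurable_compose_countable[where f="\<lambda>x p. limit_stage (fst p) x" and g=snd]) (rule measurable_compose[OF measurable_fst r], rule measurable_snd)
  then show ?thesis by (simp add: case_prod_beta')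
qed

end

section \<open>Sign symmetry\<close>

lemma along_undefined [simp]: "along j $ undefined = j"
  by (simp add: along_def)

lemma flip_flip [simp]: "flip S (flip S \<gamma>) = \<gamma>"
  by (auto simp: flip_def)

lemma coin_sign_flip: "coin_sign (flip S \<gamma> x) = (if x \<in> S then - coin_sign (\<gamma> x) else coin_sign (\<gamma> x))"
  by (simp add: flip_def coin_sign_def)

lemma integral_antisymmetric:
  fixes f :: "('d::finite) config \<Rightarrow> real"
  assumes "finitary f" "\<And>\<gamma>. f (flip S \<gamma>) = - f \<gamma>"
  shows "(\<integral>\<gamma>. f \<gamma> \<partial>coin_measure) = 0"
proof -
  have "(\<integral>\<gamma>. f \<gamma> \<partial>coin_measure) = (\<integral>\<gamma>. f (flip S \<gamma>) \<partial>coin_measure)"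
    using integral_reindex_flip[of "\<lambda>x. x" f S] assms(1) by (simp add: flip_def)
  also have "\<dots> = - (\<integral>\<gamma>. f \<gamma> \<partial>coin_measure)"
    by (simp add: assms(2))
  finally show ?thesis by simp
qed

lemma finitary_coin_sign: "finitary (\<lambda>\<gamma>. coin_sign (\<gamma> x))"
  by (rule finitary_comp[OF finitary_coord])

lemma finitary_signs:
  assumes "finitary G"
  shows "finitary (\<lambda>\<gamma>. coin_sign (\<gamma> x) * coin_sign (\<gamma> y) * of_bool (G \<gamma>))"
  by (rule finitary_comp2[OF finitary_comp2[OF finitary_coin_sign finitary_coin_sign, where h="(*)"]
    finitary_comp[OF assms], where h="(*)"])

text \<open>Flipping the whole line through \<open>x\<close> toggles no edge, so it preserves
  \<open>G\<close>; it reverses the sign at \<open>x\<close> and keeps the one at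
  \<open>y\<close>.\<close>

lemma integral_signs_off_line:
  fixes G :: "('d::finite) config \<Rightarrow> bool"
  assumes "finitary G" and inv: "\<And>\<gamma> S. flippable \<gamma> S \<Longrightarrow> G (flip S \<gamma>) = G \<gamma>"
    and "\<And>j. y \<noteq> x + along j"
  shows "(\<integral>\<gamma>. coin_sign (\<gamma> x) * coin_sign (\<gamma> y) * of_bool (G \<gamma>) \<partial>coin_measure) = 0"
proof (rule integral_antisymmetric[OF finitary_signs[OF assms(1)]])
  define S where "S = range (\<lambda>j. x + along j)"
  have "z \<in> S \<longleftrightarrow> z + along 1 \<in> S" for z
  proof
    assume "z \<in> S"
    then obtain j where "z = x + along j" by (auto simp: S_def)
    then have "z + along 1 = x + along (j + 1)" by (simp add: along_add add.assoc)
    then show "z + along 1 \<in> S" by (simp add: S_def)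
  next
    assume "z + along 1 \<in> S"
    then obtain j where "z + along 1 = x + along j" by (auto simp: S_def)
    moreover have "along j = (along (j - 1) :: 'd site) + along 1" by (simp add: along_add[symmetric])
    ultimately have "z = x + along (j - 1)" by (simp add: add.assoc[symmetric])
    then show "z \<in> S" by (simp add: S_def)
  qed
  then have "flippable \<gamma> S" for \<gamma> by (simp add: flippable_def)
  then have G: "G (flip S \<gamma>) = G \<gamma>" for \<gamma> by (rule inv)
  have "x \<in> S" unfolding S_def by (rule range_eqI[of _ _ 0]) simp
  moreover have "y \<notin> S" using assms(3) by (auto simp: S_def)
  ultimately show "coin_sign (flip S \<gamma> x) * coin_sign (flip S \<gamma> y) * of_bool (G (flip S \<gamma>)) =
      - (coin_sign (\<gamma> x) * coin_sign (\<gamma> y) * of_bool (G \<gamma>))" for \<gamma>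
    by (simp add: coin_sign_flip G)
qed

text \<open>Conditioning on the leftmost cut between \<open>x\<close> and \<open>y\<close> and flipping everything to its
  right reverses the sign of exactly one of the two coins.\<close>

lemma integral_signs_on_line:
  fixes G :: "('d::finite) config \<Rightarrow> bool"
  assumes G: "finitary G" and inv: "\<And>\<gamma> S. flippable \<gamma> S \<Longrightarrow> G (flip S \<gamma>) = G \<gamma>"
  shows "(\<integral>\<gamma>. coin_sign (\<gamma> x) * coin_sign (\<gamma> (x + along j)) * of_bool (G \<gamma>) \<partial>coin_measure)
    \<le> measure coin_measure {\<gamma>. G \<gamma> \<and> uncut \<gamma> x j}"
proof -
  define I where "I = {min 0 j..<max 0 j}"
  define s where "s \<gamma> = coin_sign (\<gamma> x) * coin_sign (\<gamma> (x + along j))" for \<gamma>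
  \<comment> \<open>For \<open>c\<close> in \<open>I\<close>, this is the part of \<open>G\<close>
    on which \<open>c\<close> is the leftmost cut between the two sites.\<close>
  define E where "E c \<gamma> \<longleftrightarrow> G \<gamma> \<and> cut_at \<gamma> (x + along c) \<and> (\<forall>i\<in>I. i < c \<longrightarrow> \<not> cut_at \<gamma> (x + along i))" for c \<gamma>
  have finI: "finite I" by (simp add: I_def)
  have finE: "finitary (E c)" for c
    unfolding E_def[abs_def]
    by (rule finitary_comp2[where h="(\<and>)", OF G], rule finitary_comp2[where h="(\<and>)", OF finitary_cut],
        rule finitary_Ball[OF finI], rule finitary_comp[OF finitary_cut])
  have zero: "(\<integral>\<gamma>. s \<gamma> * of_bool (E c \<gamma>) \<partial>coin_measure) = 0" if c: "c \<in> I" for c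
    unfolding s_def
  proof (rule integral_antisymmetric[OF finitary_signs[OF finE]])
    define S where "S = (\<lambda>i. x + along i) ` {c<..}"
    have mem: "x + along i \<in> S \<longleftrightarrow> c < i" for i by (auto simp: S_def)
    have flippable: "flippable \<gamma> S" if "cut_at \<gamma> (x + along c)" for \<gamma>
      unfolding flippable_def
    proof (intro allI impI)
      fix z assume z: "(z \<in> S) \<noteq> (z + along 1 \<in> S)"
      have "\<exists>i. z = x + along i"
      proof (cases "z \<in> S")
        case False
        then obtain i where "z + along 1 = x + along i" using z by (auto simp: S_def)
        moreover have "along i = (along (i - 1) :: 'd site) + along 1" by (simp add: along_add[symmetric])
        ultimately have "z = x + along (i - 1)" by (simp add: add.assoc[symmetric])
        then show ?thesis ..
      qed (auto simp: S_def)
      then obtain i where i: "z = x + along i" ..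
      then have "z + along 1 = x + along (i + 1)" by (simp only: along_add add.assoc)
      then have "(c < i) \<noteq> (c < i + 1)" using z mem[of i] mem[of "i + 1"] i by metis
      then have "i = c" by linarith
      then show "cut_at \<gamma> z" using i that by simp
    qed
    have E: "E c (flip S \<gamma>) = E c \<gamma>" for \<gamma>
    proof (cases "cut_at \<gamma> (x + along c)")
      case True
      from flippable[OF this] show ?thesis by (simp add: E_def cut_flip inv)
    next
      case False
      \<comment> \<open>\<open>S\<close> is known to be flippable only in the presence of a cut at
        \<open>c\<close>, so a cut created by the flip is refuted by flipping back.\<close>
      have "\<not> cut_at (flip S \<gamma>) (x + along c)"
      proof
        assume *: "cut_at (flip S \<gamma>) (x + along c)"
        from cut_flip[OF flippable[OF this], of "x + along c"] * False show False by simp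
      qed
      with False show ?thesis by (simp add: E_def)
    qed
    \<comment> \<open>Since \<open>c\<close> lies in \<open>I\<close>, exactly one of the two sites
      is on the ray \<open>S\<close>, whatever the sign of \<open>j\<close>.\<close>
    have "(x \<in> S) \<noteq> (x + along j \<in> S)"
      using mem[of 0] mem[of j] c by (auto simp: I_def)
    then show "coin_sign (flip S \<gamma> x) * coin_sign (flip S \<gamma> (x + along j)) * of_bool (E c (flip S \<gamma>)) =
        - (coin_sign (\<gamma> x) * coin_sign (\<gamma> (x + along j)) * of_bool (E c \<gamma>))" for \<gamma>
      by (auto simp: coin_sign_flip E)
  qed
  \<comment> \<open>Within \<open>G\<close>, either no cut separates the sites or exactly one
    \<open>c\<close> is the leftmost; the latter parts contribute 0 by \<open>zero\<close>.\<close>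
  have split: "of_bool (G \<gamma>) = of_bool (G \<gamma> \<and> uncut \<gamma> x j) + (\<Sum>c\<in>I. of_bool (E c \<gamma>) :: real)" for \<gamma>
  proof (cases "G \<gamma> \<and> \<not> uncut \<gamma> x j")
    case True
    let ?C = "{c\<in>I. cut_at \<gamma> (x + along c)}"
    obtain i where "i \<in> I" "cut_at \<gamma> (x + along i)" using True unfolding uncut_def I_def by blast
    then have C: "finite ?C" "?C \<noteq> {}" using finI by (simp, blast)
    note Min = Min_in[OF C] Min_le[OF C(1)]
    have "E c \<gamma> \<longleftrightarrow> c = Min ?C" if "c \<in> I" for c
    proof
      assume E: "E c \<gamma>"
      then have "c \<in> ?C" using that by (simp add: E_def)
      then have "Min ?C \<le> c" by (rule Min(2))
      moreover have "\<not> Min ?C < c" using E Min(1) unfolding E_def by blast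
      ultimately show "c = Min ?C" by simp
    next
      assume c: "c = Min ?C"
      have "\<not> cut_at \<gamma> (x + along i)" if "i \<in> I" "i < c" for i
        using Min(2)[of i] that unfolding c by auto
      then show "E c \<gamma>" using True Min(1) unfolding E_def c by blast
    qed
    then have "(\<Sum>c\<in>I. of_bool (E c \<gamma>) :: real) = (\<Sum>c\<in>I. if c = Min ?C then 1 else 0)"
      by (intro sum.cong) simp_all
    also have "\<dots> = 1" using Min(1) finI by (simp add: sum.delta)
    finally show ?thesis using True by simp
  next
    case False
    then have "\<not> E c \<gamma>" if "c \<in> I" for c using that unfolding E_def uncut_def I_def by blast
    then have "(\<Sum>c\<in>I. of_bool (E c \<gamma>) :: real) = 0" by (intro sum.neutral) simp
    then show ?thesis using False by (cases "G \<gamma>") simp_all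
  qed
  have finU: "finitary (\<lambda>\<gamma>. G \<gamma> \<and> uncut \<gamma> x j)"
    by (rule finitary_comp2[where h="(\<and>)", OF G finitary_uncut])
  have finH: "finitary (\<lambda>\<gamma>. s \<gamma> * of_bool (H \<gamma>))" if "finitary H" for H
    unfolding s_def by (rule finitary_signs[OF that])
  note int = finitary_integrable[OF finH]
  have "(\<integral>\<gamma>. s \<gamma> * of_bool (G \<gamma>) \<partial>coin_measure) =
    (\<integral>\<gamma>. s \<gamma> * of_bool (G \<gamma> \<and> uncut \<gamma> x j) + (\<Sum>c\<in>I. s \<gamma> * of_bool (E c \<gamma>)) \<partial>coin_measure)"
    by (rule Bochner_Integration.integral_cong[OF refl]) (simp only: split distrib_left sum_distrib_left)
  also have "\<dots> = (\<integral>\<gamma>. s \<gamma> * of_bool (G \<gamma> \<and> uncut \<gamma> x j) \<partial>coin_measure) +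
      (\<integral>\<gamma>. (\<Sum>c\<in>I. s \<gamma> * of_bool (E c \<gamma>)) \<partial>coin_measure)"
    by (rule Bochner_Integration.integral_add[OF int[OF finU] Bochner_Integration.integrable_sum]) (rule int[OF finE])
  also have "(\<integral>\<gamma>. (\<Sum>c\<in>I. s \<gamma> * of_bool (E c \<gamma>)) \<partial>coin_measure) = 0"
  proof -
    have "(\<integral>\<gamma>. (\<Sum>c\<in>I. s \<gamma> * of_bool (E c \<gamma>)) \<partial>coin_measure) = (\<Sum>c\<in>I. \<integral>\<gamma>. s \<gamma> * of_bool (E c \<gamma>) \<partial>coin_measure)"
      by (rule Bochner_Integration.integral_sum) (rule int[OF finE])
    also have "\<dots> = 0" by (rule sum.neutral) (simp add: zero)
    finally show ?thesis .
  qed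
  also have "(\<integral>\<gamma>. s \<gamma> * of_bool (G \<gamma> \<and> uncut \<gamma> x j) \<partial>coin_measure) + 0 =
      (\<integral>\<gamma>. s \<gamma> * of_bool (G \<gamma> \<and> uncut \<gamma> x j) \<partial>coin_measure)"
    by simp
  also have "\<dots> \<le> (\<integral>\<gamma>. of_bool (G \<gamma> \<and> uncut \<gamma> x j) \<partial>coin_measure)"
  proof (rule integral_mono[OF int[OF finU] finitary_integrable[OF finitary_comp[OF finU]]])
    fix \<gamma>
    have "s \<gamma> \<le> 1" by (simp add: s_def coin_sign_def)
    then show "s \<gamma> * of_bool (G \<gamma> \<and> uncut \<gamma> x j) \<le> of_bool (G \<gamma> \<and> uncut \<gamma> x j)"
      using mult_right_mono[of "s \<gamma>" 1 "of_bool (G \<gamma> \<and> uncut \<gamma> x j)"] by simp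
  qed
  finally show ?thesis unfolding prob_eq_integral s_def .
qed

text \<open>Edges six apart are decided by disjoint blocks of six coins, and one word on such a
  block already forces a cut. Each block avoids that word with probability
  \<open>63/64\<close>.\<close>

lemma prob_uncut:
  "measure coin_measure {\<gamma> :: ('d::finite) config. uncut \<gamma> 0 j} \<le> (63/64) ^ (nat \<bar>j\<bar> div 6)"
proof -
  interpret prob_space "coin_measure :: 'd config measure" by (rule prob_space_coin)
  define N where "N = nat \<bar>j\<bar> div 6"
  define p where "p t = min 0 j + 6 * int t" for t :: nat
  \<comment> \<open>On the sites \<open>p t - 3\<close> to \<open>p t + 2\<close> this periodic word
    reads \<open>0 1 0 0 0 0\<close>; its edges are \<open>1 1 0 0 0\<close>, which is a cut at
    \<open>p t\<close>.\<close>
  define w :: "'d config" where "w z \<longleftrightarrow> (z $ undefined - min 0 j + 3) mod 6 = 1" for z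
  define B where "B t = (along ` {p t - 3..p t + 2} :: 'd site set)" for t
  have wB: "w (along (p t + i)) \<longleftrightarrow> (i + 3) mod 6 = 1" for t i
  proof -
    have "p t + i - min 0 j + 3 = (i + 3) + 6 * int t" by (simp add: p_def)
    then show ?thesis by (simp only: w_def along_undefined mod_mult_self2)
  qed
  have inj: "inj_on (along :: int \<Rightarrow> 'd site) X" for X by (simp add: inj_on_def)
  have "uncut \<gamma> 0 j \<Longrightarrow> t < N \<Longrightarrow> \<not> (\<forall>x\<in>B t. \<gamma> x = w x)" for \<gamma> t
  proof
    assume u: "uncut \<gamma> 0 j" and t: "t < N" and m: "\<forall>x\<in>B t. \<gamma> x = w x"
    have g: "\<gamma> (along (p t + i)) \<longleftrightarrow> (i + 3) mod 6 = 1" if "-3 \<le> i" "i \<le> 2" for i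
      using m that by (simp add: B_def wB)
    have e: "edge \<gamma> (along (p t + i)) \<longleftrightarrow> ((i + 3) mod 6 = 1) \<noteq> ((i + 4) mod 6 = 1)" if "-3 \<le> i" "i \<le> 1" for i
    proof -
      have "along (p t + i) + along 1 = (along (p t + (i + 1)) :: 'd site)" by (simp add: along_add add.assoc)
      then show ?thesis using g[of i] g[of "i + 1"] that by (simp add: edge_def add.assoc)
    qed
    have "cut_at \<gamma> (0 + along (p t))"
      unfolding cut_along using e[of "-3"] e[of "-2"] e[of "-1"] e[of 1] by simp
    moreover have "p t \<in> {min 0 j..<max 0 j}"
    proof -
      have "6 * Suc t \<le> nat \<bar>j\<bar>" using t by (simp add: N_def)
      then show ?thesis by (auto simp: p_def min_def max_def)
    qed
    ultimately show False using u by (simp add: uncut_def)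
  qed
  then have "{\<gamma> :: 'd config. uncut \<gamma> 0 j} \<subseteq> {\<gamma>. (\<forall>x\<in>{}. \<gamma> x = w x) \<and> (\<forall>t\<in>{..<N}. \<not> (\<forall>x\<in>B t. \<gamma> x = w x))}" (is "_ \<subseteq> ?A")
    by auto
  moreover have fA: "?A \<in> sets coin_measure"
  proof (rule finitary_sets, rule finitary_comp2[where h="(\<and>)"])
    have eq: "finitary (\<lambda>\<gamma>. \<gamma> x = w x)" for x by (rule finitary_comp[OF finitary_coord])
    have "finitary (\<lambda>\<gamma>. \<forall>x\<in>B t. \<gamma> x = w x)" for t
      by (rule finitary_Ball) (auto simp: B_def eq)
    then show "finitary (\<lambda>\<gamma>. \<forall>t\<in>{..<N}. \<not> (\<forall>x\<in>B t. \<gamma> x = w x))"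
      by (rule finitary_Ball[OF finite_lessThan finitary_comp[where h=Not]])
  qed simp
  ultimately have "measure coin_measure {\<gamma> :: 'd config. uncut \<gamma> 0 j} \<le> measure coin_measure ?A"
    by (rule finite_measure_mono)
  also have "\<dots> = (1/2) ^ card ({} :: 'd site set) * (1 - (1/2) ^ 6) ^ card {..<N}"
  proof (rule prob_avoid_blocks)
    show "disjoint_family_on B {..<N}"
      by (auto simp: disjoint_family_on_def B_def p_def)
    show "finite (B t) \<and> card (B t) = 6 \<and> B t \<inter> {} = {}" for t
      by (simp add: B_def card_image[OF inj])
  qed auto
  finally have "measure coin_measure {\<gamma> :: 'd config. uncut \<gamma> 0 j} \<le> (1 - (1/2) ^ 6) ^ N" by simp
  moreover have "1 - (1/2) ^ 6 = (63/64 :: real)" by (simp add: power_divide)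
  ultimately show ?thesis by (simp only: N_def)
qed

text \<open>Each exponent occurs at most six times, leaving six geometric series.\<close>

lemma sum_power_div:
  fixes q :: real
  assumes "0 \<le> q" "q < 1"
  shows "(\<Sum>j<n. q ^ (j div 6)) \<le> 6 / (1 - q)"
proof -
  have "(\<Sum>j<6 * T. q ^ (j div 6)) = 6 * (\<Sum>t<T. q ^ t)" for T
  proof (induction T)
    case (Suc T)
    have "6 * Suc T = Suc (Suc (Suc (Suc (Suc (Suc (6 * T))))))" by simp
    moreover have "Suc (6 * T) div 6 = T" "Suc (Suc (6 * T)) div 6 = T" "Suc (Suc (Suc (6 * T))) div 6 = T"
      "Suc (Suc (Suc (Suc (6 * T)))) div 6 = T" "Suc (Suc (Suc (Suc (Suc (6 * T))))) div 6 = T"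
      by linarith+
    ultimately show ?case using Suc by (simp only: sum.lessThan_Suc) simp
  qed simp
  moreover have "(\<Sum>j<n. q ^ (j div 6)) \<le> (\<Sum>j<6 * n. q ^ (j div 6))"
    by (rule sum_mono2) (use assms in auto)
  moreover have "(\<Sum>t<n. q ^ t) \<le> 1 / (1 - q)"
    using assms by (subst sum_gp_strict) (auto simp: divide_right_mono)
  ultimately show ?thesis by simp
qed

lemma sum_prob_uncut:
  "(\<Sum>j\<in>{- int J..int J}. measure coin_measure {\<gamma> :: ('d::finite) config. uncut \<gamma> 0 j}) \<le> 768"
proof -
  let ?q = "63/64 :: real"
  have "(\<Sum>j\<in>{- int J..int J}. measure coin_measure {\<gamma> :: 'd config. uncut \<gamma> 0 j})
      \<le> (\<Sum>j\<in>{- int J..int J}. ?q ^ (nat \<bar>j\<bar> div 6))"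
    by (rule sum_mono) (rule prob_uncut)
  also have "\<dots> \<le> (\<Sum>j\<in>int ` {..<Suc J} \<union> (\<lambda>i. - int i) ` {..<Suc J}. ?q ^ (nat \<bar>j\<bar> div 6))"
  proof (rule sum_mono2)
    show "{- int J..int J} \<subseteq> int ` {..<Suc J} \<union> (\<lambda>i. - int i) ` {..<Suc J}"
    proof
      fix j assume "j \<in> {- int J..int J}"
      then have "j = int (nat \<bar>j\<bar>) \<or> j = - int (nat \<bar>j\<bar>)" "nat \<bar>j\<bar> < Suc J" by auto
      then show "j \<in> int ` {..<Suc J} \<union> (\<lambda>i. - int i) ` {..<Suc J}" by blast
    qed
  qed auto
  also have "\<dots> \<le> (\<Sum>j\<in>int ` {..<Suc J}. ?q ^ (nat \<bar>j\<bar> div 6)) + (\<Sum>j\<in>(\<lambda>i. - int i) ` {..<Suc J}. ?q ^ (nat \<bar>j\<bar> div 6))"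
    by (subst sum_Un) (auto intro!: sum_nonneg)
  also have "\<dots> = (\<Sum>i<Suc J. ?q ^ (i div 6)) + (\<Sum>i<Suc J. ?q ^ (i div 6))"
    by (subst (1 2) sum.reindex) (auto simp: inj_on_def)
  \<comment> \<open>Each half is at most \<open>6 * 64 = 384\<close>, hence 768; the term
    \<open>j = 0\<close> is counted twice.\<close>
  also have "\<dots> \<le> 6 / (1 - ?q) + 6 / (1 - ?q)"
    by (intro add_mono sum_power_div) auto
  finally show ?thesis by simp
qed

section \<open>The probability of staying unmatched\<close>

text \<open>The events are disjoint for distinct \<open>x\<close>. This collapses a sum over
  candidate centres of a cell into a single probability.\<close>

lemma sum_prob_fibre:
  fixes f :: "('d::finite) config \<Rightarrow> 'b"
  assumes "finite Y" "finitary f" "finitary P" "inj_on c Y"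
  shows "(\<Sum>x\<in>Y. measure coin_measure {\<gamma>. P \<gamma> \<and> f \<gamma> = c x}) = measure coin_measure {\<gamma>. P \<gamma> \<and> f \<gamma> \<in> c ` Y}"
proof -
  interpret prob_space "coin_measure :: 'd config measure" by (rule prob_space_coin)
  have "{\<gamma>. P \<gamma> \<and> f \<gamma> \<in> c ` Y} = (\<Union>x\<in>Y. {\<gamma>. P \<gamma> \<and> f \<gamma> = c x})" by auto
  moreover have "measure coin_measure (\<Union>x\<in>Y. {\<gamma>. P \<gamma> \<and> f \<gamma> = c x}) = (\<Sum>x\<in>Y. measure coin_measure {\<gamma>. P \<gamma> \<and> f \<gamma> = c x})"
  proof (rule finite_measure_finite_Union[OF assms(1)])
    have "{\<gamma>. P \<gamma> \<and> f \<gamma> = c x} \<in> sets coin_measure" for x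
      by (rule finitary_sets) (rule finitary_comp2[OF assms(3) finitary_comp[OF assms(2)], where h="(\<and>)"])
    then show "(\<lambda>x. {\<gamma>. P \<gamma> \<and> f \<gamma> = c x}) ` Y \<subseteq> sets coin_measure" by blast
    show "disjoint_family_on (\<lambda>x. {\<gamma>. P \<gamma> \<and> f \<gamma> = c x}) Y"
      using assms(4) by (auto simp: disjoint_family_on_def inj_on_def)
  qed
  ultimately show ?thesis by simp
qed

section \<open>Density of seeds\<close>

lemma along_Suc: "along (int i) + along 1 = along (int (Suc i))"
  by (simp add: along_add[symmetric] add.commute)

text \<open>Only two colourings of the \<open>k + 1\<close> sites alternate, each of probability
  \<open>(1/2) ^ Suc k\<close>.\<close>

lemma prob_seed: "measure coin_measure {\<gamma> :: ('d::finite) config. seed k \<gamma> 0} \<le> (1/2) ^ k"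
proof -
  interpret prob_space "coin_measure :: 'd config measure" by (rule prob_space_coin)
  define F where "F = (\<lambda>i. along (int i) :: 'd site) ` {..k}"
  define A where "A t = {\<gamma> :: 'd config. \<forall>x\<in>F. \<gamma> x = (even (x $ undefined) = t)}" for t
  have card: "card F = Suc k" unfolding F_def by (subst card_image) (auto simp: inj_on_def)
  \<comment> \<open>With an empty family of blocks, \<open>prob_avoid_blocks\<close> is just the
    probability of a cylinder.\<close>
  have A: "measure coin_measure (A t) = (1/2) ^ Suc k" for t
    using prob_avoid_blocks[of "{} :: nat set" F "\<lambda>_. {}" _ "\<lambda>x. even (x $ undefined) = t"]
    by (simp add: A_def card) (simp add: F_def disjoint_family_on_def)
  have sets: "A t \<in> sets coin_measure" for t
    using cylinder_sets[of F "\<lambda>x. {even (x $ undefined) = t}"] by (simp add: A_def F_def)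
  have "{\<gamma>. seed k \<gamma> 0} \<subseteq> A True \<union> A False"
  proof
    fix \<gamma> :: "'d config" assume "\<gamma> \<in> {\<gamma>. seed k \<gamma> 0}"
    then have e: "\<gamma> (along (int i)) \<noteq> \<gamma> (along (int (Suc i)))" if "i < k" for i
      using that unfolding seed_def edge_def by (simp add: add.assoc along_Suc del: of_nat_Suc)
    have "\<gamma> (along (int i)) = (even i = \<gamma> 0)" if "i \<le> k" for i
      using that
    proof (induction i)
      case (Suc i)
      then have "\<gamma> (along (int i)) = (even i = \<gamma> 0)" by simp
      moreover have "\<gamma> (along (int i)) \<noteq> \<gamma> (along (int (Suc i)))" using e Suc.prems by simp
      ultimately show ?case by (cases "\<gamma> (along (int i))"; cases "\<gamma> (along (int (Suc i)))") auto
    qed simp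
    then show "\<gamma> \<in> A True \<union> A False" by (cases "\<gamma> 0") (auto simp: A_def F_def)
  qed
  then have "measure coin_measure {\<gamma> :: 'd config. seed k \<gamma> 0} \<le> measure coin_measure (A True \<union> A False)"
    by (rule finite_measure_mono) (rule sets.Un[OF sets sets])
  also have "\<dots> \<le> measure coin_measure (A True) + measure coin_measure (A False)"
    by (rule measure_Un_le) (rule sets)+
  also have "\<dots> = (1/2) ^ k"
    unfolding A by simp
  finally show ?thesis .
qed

text \<open>The ball contains disjoint segments of \<open>Suc k\<close> sites, \<open>t\<close> to
  the dimension in number. None of them may carry the alternating word \<open>w\<close>, which would
  make its first site a seed.\<close>

lemma prob_no_seed:
  "measure coin_measure {\<gamma> :: ('d::finite) config. \<forall>v\<in>sball (Suc k * t). \<not> seed k \<gamma> v} \<le>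
    (1 - (1/2) ^ Suc k) ^ (t ^ CARD('d))"
proof -
  interpret prob_space "coin_measure :: 'd config measure" by (rule prob_space_coin)
  define I where "I = PiE (UNIV :: 'd set) (\<lambda>_. {..<t})"
  \<comment> \<open>Starting points are spaced by \<open>Suc k\<close> in the run direction, so that
    segments do not overlap, and by 1 in all other directions.\<close>
  define p where "p f = (\<chi> i. if i = undefined then int (Suc k * f i) else int (f i))" for f :: "'d \<Rightarrow> nat"
  define B where "B f = (\<lambda>i. p f + along (int i)) ` {..k}" for f
  define w :: "'d config" where "w x = even (x $ undefined)" for x
  have I: "finite I" "card I = t ^ CARD('d)"
    unfolding I_def by (auto intro!: finite_PiE simp: card_PiE)
  have nth: "(p f + along (int i)) $ u = (if u = undefined then int (Suc k * f u + i) else int (f u))" for f i u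
    by (simp add: p_def along_def axis_def)
  have dis: "disjoint_family_on B I"
    unfolding disjoint_family_on_def
  proof (intro ballI impI)
    fix f g assume fg: "f \<in> I" "g \<in> I" "f \<noteq> g"
    show "B f \<inter> B g = {}"
    proof (rule ccontr)
      assume "B f \<inter> B g \<noteq> {}"
      then obtain i j where ij: "i \<le> k" "j \<le> k" "p f + along (int i) = p g + along (int j)"
        by (auto simp: B_def)
      have eq: "(if u = undefined then int (Suc k * f u + i) else int (f u)) =
          (if u = undefined then int (Suc k * g u + j) else int (g u))" for u
        using arg_cong[OF ij(3), of "\<lambda>x. x $ u"] by (simp only: nth)
      have "f u = g u" for u
      proof (cases "u = undefined")
        case True
        then have "Suc k * f u + i = Suc k * g u + j" using eq[of undefined] by (simp only: simp_thms if_True of_nat_eq_iff)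
        then have "(Suc k * f u + i) div Suc k = (Suc k * g u + j) div Suc k" by simp
        then show ?thesis using ij(1,2) by (simp only: div_mult_self4) simp
      next
        case False
        then show ?thesis using eq[of u] by simp
      qed
      then show False using fg by blast
    qed
  qed
  have B: "finite (B f) \<and> card (B f) = Suc k \<and> B f \<inter> {} = {}" for f
    unfolding B_def by (subst card_image) (auto simp: inj_on_def)
  have seed: "seed k \<gamma> (p f)" if "\<forall>x\<in>B f. \<gamma> x = w x" for \<gamma> f
    unfolding seed_def edge_def
  proof (intro allI impI)
    fix i assume "i < k"
    have g: "\<gamma> (p f + along (int i')) = w (p f + along (int i'))" if "i' \<le> k" for i'
      using \<open>\<forall>x\<in>B f. \<gamma> x = w x\<close> that unfolding B_def by blast
    have s: "p f + along (int i) + along 1 = p f + along (int (Suc i))"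
      by (simp only: add.assoc along_Suc)
    have "\<gamma> (p f + along (int i)) = w (p f + along (int i))"
      "\<gamma> (p f + along (int (Suc i))) = w (p f + along (int (Suc i)))"
      using g[of i] g[of "Suc i"] \<open>i < k\<close> by simp_all
    then show "\<gamma> (p f + along (int i)) \<noteq> \<gamma> (p f + along (int i) + along 1)"
      unfolding s w_def nth by simp
  qed
  have ball: "p f \<in> sball (Suc k * t)" if "f \<in> I" for f
  proof -
    have ft: "f u \<le> t" for u using that by (auto simp: I_def PiE_iff less_imp_le)
    have "\<bar>p f $ u\<bar> \<le> int (Suc k * t)" for u
    proof -
      have "f u \<le> Suc k * t" using ft[of u] by simp
      moreover have "Suc k * f u \<le> Suc k * t" using ft[of u] by (rule mult_le_mono2)
      ultimately have "(if u = undefined then Suc k * f u else f u) \<le> Suc k * t"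
        by (cases "u = undefined") (simp_all only: if_True if_False simp_thms)
      then have "int (if u = undefined then Suc k * f u else f u) \<le> int (Suc k * t)" by (simp only: of_nat_le_iff)
      then show ?thesis by (simp add: p_def split: if_splits)
    qed
    then show ?thesis by (simp only: sball_def linf_norm_le_iff mem_Collect_eq) simp
  qed
  have "{\<gamma> :: 'd config. \<forall>v\<in>sball (Suc k * t). \<not> seed k \<gamma> v} \<subseteq>
      {\<gamma>. (\<forall>x\<in>{}. \<gamma> x = w x) \<and> (\<forall>f\<in>I. \<not> (\<forall>x\<in>B f. \<gamma> x = w x))}" (is "_ \<subseteq> ?A")
    using seed ball by blast
  moreover have "?A \<in> sets coin_measure"
  proof (rule finitary_sets, rule finitary_comp2[where h="(\<and>)"])
    have "finitary (\<lambda>\<gamma>. \<forall>x\<in>B f. \<gamma> x = w x)" for f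
      using B by (intro finitary_Ball finitary_comp[OF finitary_coord]) auto
    then show "finitary (\<lambda>\<gamma>. \<forall>f\<in>I. \<not> (\<forall>x\<in>B f. \<gamma> x = w x))"
      by (rule finitary_Ball[OF I(1) finitary_comp[where h=Not]])
  qed simp
  ultimately have "measure coin_measure {\<gamma> :: 'd config. \<forall>v\<in>sball (Suc k * t). \<not> seed k \<gamma> v} \<le> measure coin_measure ?A"
    by (rule finite_measure_mono)
  also have "\<dots> = (1/2) ^ card ({} :: 'd site set) * (1 - (1/2) ^ Suc k) ^ card I"
    by (rule prob_avoid_blocks[OF I(1) _ dis B]) simp
  finally show ?thesis by (simp only: I(2) card.empty power_0 mult_1)
qed

section \<open>Discrepancy of the cell centred at the origin\<close>

context hierarchy
begin

text \<open>The ball contains every cell centred at the origin, so it only serves to make the sum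
  finite with a deterministic range.\<close>

definition discrepancy :: "nat \<Rightarrow> ('d::finite) config \<Rightarrow> real" where
  "discrepancy n \<gamma> = (\<Sum>x\<in>sball (reach n). coin_sign (\<gamma> x) * of_bool (ctr n \<gamma> x = 0))"

lemma finitary_discrepancy: "finitary (discrepancy n)"
  unfolding discrepancy_def[abs_def]
  by (rule finitary_sum[OF finite_sball])
    (rule finitary_comp2[OF finitary_coin_sign finitary_comp[OF finitary_ctr], where h="(*)"])

text \<open>Sites \<open>y\<close> off the line of \<open>x\<close> contribute nothing, the others
  at most the probability of having no cut in between. Translating \<open>x\<close> to the origin
  turns the condition on its centre into \<open>ctr n \<gamma> 0 = - x\<close>.\<close>

lemma integral_cell_signs:
  fixes x :: "('d::finite) site"
  assumes "x \<in> sball (reach n)"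
  shows "(\<Sum>y\<in>sball (reach n). \<integral>\<gamma>. coin_sign (\<gamma> x) * coin_sign (\<gamma> y) *
      of_bool (ctr n \<gamma> x = 0 \<and> ctr n \<gamma> y = 0) \<partial>coin_measure)
    \<le> (\<Sum>j\<in>{- int (2 * reach n)..int (2 * reach n)}.
        measure coin_measure {\<gamma> :: 'd config. uncut \<gamma> 0 j \<and> ctr n \<gamma> 0 = - x})"
proof -
  interpret prob_space "coin_measure :: 'd config measure" by (rule prob_space_coin)
  define J where "J = {- int (2 * reach n)..int (2 * reach n)}"
  define A where "A j = measure coin_measure {\<gamma> :: 'd config. uncut \<gamma> 0 j \<and> ctr n \<gamma> 0 = - x}" for j
  define a where "a y = (\<integral>\<gamma>. coin_sign (\<gamma> x) * coin_sign (\<gamma> y) * of_bool (ctr n \<gamma> x = 0 \<and> ctr n \<gamma> y = 0) \<partial>coin_measure)" for y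
  have finG: "finitary (\<lambda>\<gamma>. ctr n \<gamma> x = 0 \<and> ctr n \<gamma> y = 0)" for y
    by (rule finitary_comp2[OF finitary_comp[OF finitary_ctr] finitary_comp[OF finitary_ctr], where h="(\<and>)"])
  have finU: "finitary (\<lambda>\<gamma>. ctr n \<gamma> x = 0 \<and> uncut \<gamma> x j)" for j
    by (rule finitary_comp2[OF finitary_comp[OF finitary_ctr] finitary_uncut, where h="(\<and>)"])
  have A: "A j = measure coin_measure {\<gamma> :: 'd config. ctr n \<gamma> x = 0 \<and> uncut \<gamma> x j}" for j
  proof -
    have "ctr n (config_shift x \<gamma>) x = 0 \<longleftrightarrow> ctr n \<gamma> 0 = - x" for \<gamma>
      using ctr_shift[of n x \<gamma> 0] by (simp add: eq_neg_iff_add_eq_0)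
    moreover have "uncut (config_shift x \<gamma>) x j = uncut \<gamma> 0 j" for \<gamma>
      using uncut_shift[of x \<gamma> 0 j] by simp
    ultimately show ?thesis
      using prob_shift[OF finU[of j], of x] by (simp add: A_def conj_commute)
  qed
  have on: "a (x + along j) \<le> A j" for j
  proof -
    have "a (x + along j) \<le> measure coin_measure {\<gamma>. (ctr n \<gamma> x = 0 \<and> ctr n \<gamma> (x + along j) = 0) \<and> uncut \<gamma> x j}"
      unfolding a_def by (rule integral_signs_on_line[OF finG]) (simp add: ctr_flip)
    also have "\<dots> \<le> A j"
      unfolding A by (rule finite_measure_mono[OF _ finitary_sets[OF finU]]) blast
    finally show ?thesis .
  qed
  have off: "a y = 0" if "\<And>j. y \<noteq> x + along j" for y
    unfolding a_def by (rule integral_signs_off_line[OF finG _ that]) (simp add: ctr_flip)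
  \<comment> \<open>Both sites are within \<open>reach n\<close> of the origin, so their offset
    \<open>j\<close> is at most twice that.\<close>
  have le: "a y \<le> (\<Sum>j\<in>J. of_bool (y = x + along j) * A j)" if y: "y \<in> sball (reach n)" for y
  proof (cases "\<exists>j. y = x + along j")
    case True
    then obtain j where j: "y = x + along j" ..
    have "y - x \<in> sball (reach n + reach n)" using sball_add[OF y, of "- x"] assms by simp
    then have "\<bar>(y - x) $ undefined\<bar> \<le> int (reach n + reach n)"
      unfolding sball_def linf_norm_le_iff mem_Collect_eq by blast
    then have "j \<in> J" by (simp add: j J_def abs_le_iff)
    then have "(\<Sum>j\<in>{j}. of_bool (y = x + along j) * A j) \<le> (\<Sum>j\<in>J. of_bool (y = x + along j) * A j)"
      by (intro sum_mono2) (auto simp: J_def A_def)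
    then show ?thesis using on[of j] by (simp add: j)
  next
    case False
    then have "a y = 0" using off by blast
    then show ?thesis by (simp add: sum_nonneg A_def)
  qed
  have "(\<Sum>y\<in>sball (reach n). a y) \<le> (\<Sum>y\<in>sball (reach n). \<Sum>j\<in>J. of_bool (y = x + along j) * A j)"
    by (rule sum_mono) (rule le)
  also have "\<dots> = (\<Sum>j\<in>J. (\<Sum>y\<in>sball (reach n). of_bool (y = x + along j)) * A j)"
    by (subst sum.swap) (simp only: sum_distrib_right)
  also have "\<dots> \<le> (\<Sum>j\<in>J. 1 * A j)"
  proof (intro sum_mono mult_right_mono)
    fix j
    have "(\<Sum>y\<in>sball (reach n). of_bool (y = x + along j) :: real) = of_bool (x + along j \<in> sball (reach n))"
      by (simp add: of_bool_def sum.delta)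
    then show "(\<Sum>y\<in>sball (reach n). of_bool (y = x + along j) :: real) \<le> 1" by simp
  qed (simp add: A_def)
  finally show ?thesis by (simp add: a_def A_def J_def)
qed

text \<open>Keeping the condition on the centre of 0 makes the events disjoint in \<open>x\<close>,
  so the sum over \<open>x\<close> collapses and the bound does not grow with the cells.\<close>

lemma second_moment: "(\<integral>\<gamma>. (discrepancy n \<gamma>)\<^sup>2 \<partial>(coin_measure :: ('d::finite) config measure)) \<le> 768"
proof -
  interpret prob_space "coin_measure :: 'd config measure" by (rule prob_space_coin)
  let ?Y = "sball (reach n) :: 'd site set"
  let ?J = "{- int (2 * reach n)..int (2 * reach n)}"
  let ?f = "\<lambda>x y \<gamma>. coin_sign (\<gamma> x) * coin_sign (\<gamma> y) * of_bool (ctr n \<gamma> x = 0 \<and> ctr n \<gamma> y = 0)"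
  have fin: "finitary (?f x y)" for x y :: "'d site"
    by (rule finitary_signs, rule finitary_comp2[OF finitary_comp[OF finitary_ctr] finitary_comp[OF finitary_ctr], where h="(\<and>)"])
  note int = finitary_integrable[OF fin]
  have "(discrepancy n \<gamma>)\<^sup>2 = (\<Sum>x\<in>?Y. \<Sum>y\<in>?Y. ?f x y \<gamma>)" for \<gamma> :: "'d config"
    unfolding discrepancy_def power2_eq_square sum_product
    by (intro sum.cong refl) (simp add: of_bool_conj mult_ac)
  then have "(\<integral>\<gamma>. (discrepancy n \<gamma>)\<^sup>2 \<partial>(coin_measure :: 'd config measure)) = (\<integral>\<gamma>. (\<Sum>x\<in>?Y. \<Sum>y\<in>?Y. ?f x y \<gamma>) \<partial>coin_measure)"
    by (simp only:)
  also have "\<dots> = (\<Sum>x\<in>?Y. \<integral>\<gamma>. (\<Sum>y\<in>?Y. ?f x y \<gamma>) \<partial>coin_measure)"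
    by (rule Bochner_Integration.integral_sum) (rule Bochner_Integration.integrable_sum, rule int)
  also have "\<dots> = (\<Sum>x\<in>?Y. \<Sum>y\<in>?Y. \<integral>\<gamma>. ?f x y \<gamma> \<partial>coin_measure)"
    by (rule sum.cong[OF refl], rule Bochner_Integration.integral_sum) (rule int)
  also have "\<dots> \<le> (\<Sum>x\<in>?Y. \<Sum>j\<in>?J. measure coin_measure {\<gamma> :: 'd config. uncut \<gamma> 0 j \<and> ctr n \<gamma> 0 = - x})"
    by (rule sum_mono) (rule integral_cell_signs)
  also have "\<dots> = (\<Sum>j\<in>?J. \<Sum>x\<in>?Y. measure coin_measure {\<gamma> :: 'd config. uncut \<gamma> 0 j \<and> ctr n \<gamma> 0 = - x})"
    by (rule sum.swap)
  also have "\<dots> \<le> (\<Sum>j\<in>?J. measure coin_measure {\<gamma> :: 'd config. uncut \<gamma> 0 j})"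
  proof (rule sum_mono)
    fix j
    have "(\<Sum>x\<in>?Y. measure coin_measure {\<gamma> :: 'd config. uncut \<gamma> 0 j \<and> ctr n \<gamma> 0 = - x}) =
        measure coin_measure {\<gamma> :: 'd config. uncut \<gamma> 0 j \<and> ctr n \<gamma> 0 \<in> uminus ` ?Y}"
      by (rule sum_prob_fibre[OF finite_sball finitary_ctr finitary_uncut]) simp
    also have "\<dots> \<le> measure coin_measure {\<gamma> :: 'd config. uncut \<gamma> 0 j}"
      by (rule finite_measure_mono[OF _ finitary_sets[OF finitary_uncut]]) blast
    finally show "(\<Sum>x\<in>?Y. measure coin_measure {\<gamma> :: 'd config. uncut \<gamma> 0 j \<and> ctr n \<gamma> 0 = - x})
        \<le> measure coin_measure {\<gamma> :: 'd config. uncut \<gamma> 0 j}" .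
  qed
  also have "\<dots> \<le> 768" by (rule sum_prob_uncut)
  finally show ?thesis .
qed

text \<open>By saturation the absolute discrepancy counts the unmatched sites whose centre is the
  origin. Translating each such site to the origin sums over all possible centres of the cell of
  0.\<close>

lemma prob_unmatched:
  "measure coin_measure {\<gamma> :: ('d::finite) config. stage n \<gamma> 0 = 0} = (\<integral>\<gamma>. \<bar>discrepancy n \<gamma>\<bar> \<partial>(coin_measure :: 'd config measure))"
proof -
  let ?Y = "sball (reach n) :: 'd site set"
  have fin: "finitary (\<lambda>\<gamma>. stage n \<gamma> x = x \<and> ctr n \<gamma> x = z)" for x z :: "'d site"
    by (rule finitary_comp2[OF finitary_comp[OF finitary_stage] finitary_comp[OF finitary_ctr], where h="(\<and>)"])
  have card: "\<bar>discrepancy n \<gamma>\<bar> = (\<Sum>x\<in>?Y. of_bool (stage n \<gamma> x = x \<and> ctr n \<gamma> x = 0))" for \<gamma> :: "'d config"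
  proof -
    let ?A = "{x. ctr n \<gamma> x = 0}"
    have sub: "?A \<subseteq> ?Y" using ctr_in_sball[of n \<gamma> 0] by auto
    have "discrepancy n \<gamma> = (\<Sum>x\<in>?Y. if x \<in> ?A then coin_sign (\<gamma> x) else 0)"
      unfolding discrepancy_def by (rule sum.cong) auto
    also have "\<dots> = (\<Sum>x\<in>?Y \<inter> ?A. coin_sign (\<gamma> x))" by (rule sum.inter_restrict[symmetric]) simp
    also have "?Y \<inter> ?A = ?A" using sub by blast
    finally have D: "discrepancy n \<gamma> = (\<Sum>x\<in>?A. coin_sign (\<gamma> x))" .
    have "real (card {x\<in>?A. stage n \<gamma> x = x}) = \<bar>\<Sum>x\<in>?A. coin_sign (\<gamma> x)\<bar>"
    proof (rule card_fixed_points[OF partial_matching_stage finite_cell])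
      have "ctr n \<gamma> (stage n \<gamma> x) = ctr n \<gamma> x" for x
        using partial_matching_stage[of n \<gamma>] unfolding partial_matching_def by blast
      then show "stage n \<gamma> ` ?A \<subseteq> ?A" by auto
      fix x y assume xy: "x \<in> ?A" "y \<in> ?A" and fixed: "stage n \<gamma> x = x" "stage n \<gamma> y = y"
      show "\<gamma> x = \<gamma> y" by (rule stage_saturated[OF fixed]) (use xy in simp)
    qed
    moreover have "{x\<in>?A. stage n \<gamma> x = x} = {x\<in>?Y. stage n \<gamma> x = x \<and> ctr n \<gamma> x = 0}" using sub by blast
    ultimately have "\<bar>discrepancy n \<gamma>\<bar> = real (card {x\<in>?Y. stage n \<gamma> x = x \<and> ctr n \<gamma> x = 0})"
      by (simp only: D)
    also have "\<dots> = (\<Sum>x\<in>{x\<in>?Y. stage n \<gamma> x = x \<and> ctr n \<gamma> x = 0}. 1)" by simp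
    also have "\<dots> = (\<Sum>x\<in>?Y. if stage n \<gamma> x = x \<and> ctr n \<gamma> x = 0 then 1 else 0)"
      by (rule sum.inter_filter) simp
    finally show ?thesis by (simp add: of_bool_def)
  qed
  have "(\<integral>\<gamma>. \<bar>discrepancy n \<gamma>\<bar> \<partial>(coin_measure :: 'd config measure)) =
      (\<Sum>x\<in>?Y. \<integral>\<gamma>. of_bool (stage n \<gamma> x = x \<and> ctr n \<gamma> x = 0) \<partial>coin_measure)"
    unfolding card by (rule Bochner_Integration.integral_sum) (rule finitary_integrable[OF finitary_comp[OF fin]])
  also have "\<dots> = (\<Sum>x\<in>?Y. measure coin_measure {\<gamma>. stage n \<gamma> 0 = 0 \<and> ctr n \<gamma> 0 = - x})"
  proof (rule sum.cong[OF refl])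
    fix x :: "'d site"
    have "stage n (config_shift x \<gamma>) x = x \<longleftrightarrow> stage n \<gamma> 0 = 0" for \<gamma>
      using stage_shift[of n x \<gamma> 0] by simp
    moreover have "ctr n (config_shift x \<gamma>) x = 0 \<longleftrightarrow> ctr n \<gamma> 0 = - x" for \<gamma>
      using ctr_shift[of n x \<gamma> 0] by (simp add: eq_neg_iff_add_eq_0)
    ultimately have "measure coin_measure {\<gamma>. stage n \<gamma> x = x \<and> ctr n \<gamma> x = 0} = measure coin_measure {\<gamma>. stage n \<gamma> 0 = 0 \<and> ctr n \<gamma> 0 = - x}"
      using prob_shift[OF fin[of x 0], of x] by simp
    then show "(\<integral>\<gamma>. of_bool (stage n \<gamma> x = x \<and> ctr n \<gamma> x = 0) \<partial>coin_measure) =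
        measure coin_measure {\<gamma>. stage n \<gamma> 0 = 0 \<and> ctr n \<gamma> 0 = - x}"
      by (simp only: prob_eq_integral)
  qed
  also have "\<dots> = measure coin_measure {\<gamma>. stage n \<gamma> 0 = 0 \<and> ctr n \<gamma> 0 \<in> uminus ` ?Y}"
    by (rule sum_prob_fibre[OF finite_sball finitary_ctr finitary_comp[OF finitary_stage]]) simp
  \<comment> \<open>By \<open>ctr_reach\<close> the centre of 0 always lies in the ball, so the
    restriction is void.\<close>
  also have "{\<gamma>. stage n \<gamma> 0 = 0 \<and> ctr n \<gamma> 0 \<in> uminus ` ?Y} = {\<gamma> :: 'd config. stage n \<gamma> 0 = 0}"
  proof -
    have "ctr n \<gamma> 0 \<in> uminus ` ?Y" for \<gamma> :: "'d config"
      by (rule image_eqI[of _ _ "- ctr n \<gamma> 0"]) (use ctr_reach[of n \<gamma> 0] in simp_all)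
    then show ?thesis by blast
  qed
  finally show ?thesis by simp
qed

text \<open>A hop ending at 0 either reached a seed there or found no seed within range; in the
  latter case it did not move, so it also started at 0.\<close>

lemma prob_centre:
  "measure coin_measure {\<gamma> :: ('d::finite) config. \<exists>x. ctr (Suc n) \<gamma> x = 0} \<le>
    measure coin_measure {\<gamma> :: 'd config. seed (k n) \<gamma> 0} +
    measure coin_measure {\<gamma> :: 'd config. \<forall>v\<in>sball (b n). \<not> seed (k n) \<gamma> v}"
proof -
  interpret prob_space "coin_measure :: 'd config measure" by (rule prob_space_coin)
  let ?S = "{\<gamma> :: 'd config. seed (k n) \<gamma> 0}" and ?N = "{\<gamma> :: 'd config. \<forall>v\<in>sball (b n). \<not> seed (k n) \<gamma> v}"
  have S: "?S \<in> sets coin_measure" by (rule finitary_sets[OF finitary_seed])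
  have N: "?N \<in> sets coin_measure"
    by (rule finitary_sets[OF finitary_Ball[OF finite_sball finitary_comp[OF finitary_seed]]])
  have "{\<gamma> :: 'd config. \<exists>x. ctr (Suc n) \<gamma> x = 0} \<subseteq> ?S \<union> ?N"
  proof
    fix \<gamma> :: "'d config" assume "\<gamma> \<in> {\<gamma>. \<exists>x. ctr (Suc n) \<gamma> x = 0}"
    then obtain y where y: "hop (k n) (b n) \<gamma> y = 0" by auto
    show "\<gamma> \<in> ?S \<union> ?N"
    proof (cases "\<exists>v\<in>sball (b n). seed (k n) \<gamma> (y + v)")
      case True
      then have "seed (k n) \<gamma> 0" using hop_seed(2)[of _ "b n" "k n" \<gamma> y] y by auto
      then show ?thesis by blast
    next
      case False
      then have "y = 0" using y by (simp add: hop_def)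
      then show ?thesis using False by auto
    qed
  qed
  then have "measure coin_measure {\<gamma> :: 'd config. \<exists>x. ctr (Suc n) \<gamma> x = 0} \<le> measure coin_measure (?S \<union> ?N)"
    by (rule finite_measure_mono) (rule sets.Un[OF S N])
  also have "\<dots> \<le> measure coin_measure ?S + measure coin_measure ?N"
    by (rule measure_Un_le[OF S N])
  finally show ?thesis .
qed

text \<open>Expanding \<open>(l * \<bar>D\<bar> - 1)\<^sup>2 / l \<ge> 0\<close> bounds
  \<open>2 * \<bar>D\<bar>\<close> when the origin is a centre; otherwise its cell is empty and
  \<open>D = 0\<close>. The weight \<open>l\<close> remains free for optimisation.\<close>

lemma prob_unmatched_le:
  assumes "0 < l"
  shows "measure coin_measure {\<gamma> :: ('d::finite) config. stage n \<gamma> 0 = 0}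
    \<le> (768 * l + measure coin_measure {\<gamma> :: 'd config. \<exists>x. ctr n \<gamma> x = 0} / l) / 2"
proof -
  have ex: "(\<exists>x. ctr n \<gamma> x = 0) \<longleftrightarrow> \<not> (\<forall>x\<in>sball (reach n). ctr n \<gamma> x \<noteq> 0)" for \<gamma> :: "'d config"
    using ctr_in_sball[of n \<gamma> 0] by auto
  have finE: "finitary (\<lambda>\<gamma> :: 'd config. \<exists>x. ctr n \<gamma> x = 0)"
    unfolding ex by (rule finitary_comp[OF finitary_Ball[OF finite_sball finitary_comp[OF finitary_ctr]], where h=Not])
  have intD: "integrable coin_measure (\<lambda>\<gamma> :: 'd config. l * (discrepancy n \<gamma>)\<^sup>2)"
    by (rule finitary_integrable[OF finitary_comp[OF finitary_discrepancy]])
  have intE: "integrable coin_measure (\<lambda>\<gamma> :: 'd config. of_bool (\<exists>x. ctr n \<gamma> x = 0) / l)"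
    by (rule finitary_integrable[OF finitary_comp[OF finE]])
  have intA: "integrable coin_measure (\<lambda>\<gamma> :: 'd config. 2 * \<bar>discrepancy n \<gamma>\<bar>)"
    by (rule finitary_integrable[OF finitary_comp[OF finitary_discrepancy]])
  have "2 * \<bar>discrepancy n \<gamma>\<bar> \<le> l * (discrepancy n \<gamma>)\<^sup>2 + of_bool (\<exists>x. ctr n \<gamma> x = 0) / l" for \<gamma> :: "'d config"
  proof (cases "\<exists>x. ctr n \<gamma> x = 0")
    case True
    have "0 \<le> (l * \<bar>discrepancy n \<gamma>\<bar> - 1)\<^sup>2 / l" using assms by simp
    also have "\<dots> = l * (discrepancy n \<gamma>)\<^sup>2 + 1 / l - 2 * \<bar>discrepancy n \<gamma>\<bar>"
      using assms by (simp add: power2_eq_square field_simps)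
    finally show ?thesis using True by simp
  next
    case False
    then have "discrepancy n \<gamma> = 0" by (simp add: discrepancy_def)
    then show ?thesis using assms by simp
  qed
  then have "(\<integral>\<gamma>. 2 * \<bar>discrepancy n \<gamma>\<bar> \<partial>(coin_measure :: 'd config measure)) \<le>
      (\<integral>\<gamma>. (l * (discrepancy n \<gamma>)\<^sup>2) + of_bool (\<exists>x. ctr n \<gamma> x = 0) / l \<partial>(coin_measure :: 'd config measure))"
    by (intro integral_mono intA Bochner_Integration.integrable_add intD intE) simp
  also have "\<dots> = (\<integral>\<gamma>. l * (discrepancy n \<gamma>)\<^sup>2 \<partial>(coin_measure :: 'd config measure)) +
      (\<integral>\<gamma>. of_bool (\<exists>x. ctr n \<gamma> x = 0) / l \<partial>(coin_measure :: 'd config measure))"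
    by (rule Bochner_Integration.integral_add[OF intD intE])
  also have "\<dots> = l * (\<integral>\<gamma>. (discrepancy n \<gamma>)\<^sup>2 \<partial>(coin_measure :: 'd config measure)) +
      measure coin_measure {\<gamma> :: 'd config. \<exists>x. ctr n \<gamma> x = 0} / l"
    by (simp add: prob_eq_integral)
  also have "\<dots> \<le> l * 768 + measure coin_measure {\<gamma> :: 'd config. \<exists>x. ctr n \<gamma> x = 0} / l"
    using assms by (intro add_right_mono mult_left_mono second_moment) simp
  finally show ?thesis by (simp add: prob_unmatched)
qed

end

section \<open>The tail of the matching distance\<close>

text \<open>This is the fourth power of \<open>y / 4 \<le> exp (y / 4)\<close>, strong enough to
  bring the no-seed probability below the order of the seed density.\<close>

lemma exp_minus_le:
  fixes y :: real
  assumes "0 < y"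
  shows "exp (- y) \<le> 256 / y ^ 4"
proof -
  have "(y / 4) ^ 4 \<le> exp (y / 4) ^ 4"
  proof (rule power_mono)
    show "y / 4 \<le> exp (y / 4)" using exp_ge_add_one_self[of "y / 4"] by linarith
  qed (use assms in simp)
  also have "\<dots> = exp y" by (simp add: exp_of_nat_mult[symmetric])
  finally have "y ^ 4 / 256 \<le> exp y" by (simp add: power_divide)
  then have "y ^ 4 * exp (- y) \<le> 256 * (exp y * exp (- y))"
    by (simp add: field_simps exp_minus)
  then show ?thesis using assms by (simp add: exp_minus field_simps)
qed

text \<open>The number of trials is \<open>2 ^ (N * d * d)\<close> times
  \<open>2 ^ (4 * d * N)\<close>, and the second factor cancels the success probability up to 2.
  With mean number \<open>y\<close> of successes the failure probability is at most
  \<open>exp (- y)\<close>.\<close>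

lemma no_seed_bound:
  fixes d N :: nat
  assumes "1 \<le> d"
  shows "(1 - (1/2 :: real) ^ Suc (4 * d * N)) ^ ((2 ^ (N * (d + 4))) ^ d) \<le> 4096 * (1/2) ^ (4 * d * N)"
proof -
  let ?p = "(1/2 :: real) ^ Suc (4 * d * N)" and ?V = "(2 ^ (N * (d + 4))) ^ d :: nat"
  define y :: real where "y = 2 ^ (N * d * d) / 2"
  have "N * (d + 4) * d = N * d * d + 4 * d * N" by (simp add: algebra_simps)
  then have V: "real ?V = 2 ^ (N * d * d) * 2 ^ (4 * d * N)"
    by (simp only: of_nat_power of_nat_mult power_mult[symmetric] power_add of_nat_numeral)
  have pV: "real ?V * ?p = y"
    unfolding V y_def by (simp add: power_one_over)
  have "(1 - ?p) ^ ?V \<le> exp (- ?p) ^ ?V"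
  proof (rule power_mono)
    show "1 - ?p \<le> exp (- ?p)" using exp_ge_add_one_self[of "- ?p"] by simp
    have "?p \<le> 1" by (rule power_le_one) auto
    then show "0 \<le> 1 - ?p" by simp
  qed
  also have "\<dots> = exp (- y)"
    unfolding exp_of_nat_mult[symmetric] mult_minus_right pV ..
  also have "\<dots> \<le> 256 / y ^ 4" by (rule exp_minus_le) (simp add: y_def)
  \<comment> \<open>\<open>4096 = 256 * 2 ^ 4\<close>, the second factor coming from the half in
    \<open>y\<close>.\<close>
  also have "\<dots> = 4096 / 2 ^ (4 * d * (N * d))"
    by (simp add: y_def power_divide power_mult[symmetric] mult_ac)
  also have "\<dots> \<le> 4096 / 2 ^ (4 * d * N)"
    using assms by (intro divide_left_mono power_increasing) auto
  also have "(4096 :: real) / 2 ^ (4 * d * N) = 4096 * (1/2) ^ (4 * d * N)"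
    by (simp only: power_one_over)
  finally show ?thesis .
qed

text \<open>Since \<open>(d + 4) * \<beta> = 2 * d\<close>, the scale \<open>R N\<close> to the
  power \<open>\<beta>\<close> is \<open>2 ^ (2 * d * N)\<close> times a polynomial factor in
  \<open>N\<close>. A general \<open>r\<close> is compared with the next scale.\<close>

lemma tail_interpolation:
  fixes F :: "real \<Rightarrow> real" and d :: nat
  assumes d: "1 \<le> d" and C: "0 \<le> C" and F1: "\<And>r. F r \<le> 1"
    and F: "\<And>N r. \<lbrakk>1 \<le> N; 4 * (4 * real d * real N + 1) * 2 ^ (N * (d + 4)) \<le> r\<rbrakk> \<Longrightarrow> F r \<le> C * (1/2) ^ (2 * d * N)"
  shows "\<exists>c. \<forall>r\<ge>2. F r \<le> c * (ln r) ^ 4 * r powr - (2 / (1 + 4 / real d))"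
proof -
  define \<beta> where "\<beta> = 2 / (1 + 4 / real d)"
  define R where "R N = 4 * (4 * real d * real N + 1) * 2 ^ (N * (d + 4))" for N :: nat
  \<comment> \<open>The first summand serves \<open>r < R 1\<close>, with 16 compensating
    \<open>(ln r) ^ 4 \<ge> 1/16\<close>. In the second, \<open>2 ^ (2 * d)\<close> pays for going
    from \<open>N\<close> to \<open>Suc N\<close>, and the square for the linear factor of
    \<open>R (Suc N)\<close>.\<close>
  define c where "c = 16 * (R 1)\<^sup>2 + C * 2 ^ (2 * d) * (4 * (8 * real d + 1))\<^sup>2"
  have \<beta>: "0 \<le> \<beta>" "\<beta> \<le> 2" "real (d + 4) * \<beta> = 2 * real d"
  proof -
    have "1 + 4 / real d = (real d + 4) / real d" using d by (simp add: add_divide_distrib)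
    then have \<beta>_eq: "\<beta> = 2 * real d / (real d + 4)" by (simp add: \<beta>_def)
    show "0 \<le> \<beta>" by (simp add: \<beta>_eq)
    show "\<beta> \<le> 2" by (simp add: \<beta>_eq divide_le_eq)
    show "real (d + 4) * \<beta> = 2 * real d" by (simp add: \<beta>_eq)
  qed
  have unbounded: "\<exists>N. r < R N" for r
  proof -
    obtain N :: nat where N: "r < 2 ^ N" using real_arch_pow[of 2 r] by auto
    have "(2::real) ^ N \<le> 2 ^ (N * (d + 4))" by (rule power_increasing) auto
    also have "\<dots> = 1 * 2 ^ (N * (d + 4))" by simp
    also have "\<dots> \<le> R N" unfolding R_def by (rule mult_right_mono) auto
    finally show ?thesis using N by (intro exI[of _ N]) simp
  qed
  have "F r \<le> c * (ln r) ^ 4 * r powr - \<beta>" if r: "2 \<le> r" for r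
  proof -
    have key: "F r \<le> K * (ln r) ^ 4 * r powr - \<beta>" if "F r * r powr \<beta> \<le> K * (ln r) ^ 4" for K
    proof -
      have "F r = F r * r powr \<beta> * r powr - \<beta>" using r by (simp add: powr_minus)
      also have "\<dots> \<le> K * (ln r) ^ 4 * r powr - \<beta>" using that by (rule mult_right_mono) simp
      finally show ?thesis .
    qed
    have ln2: "1/2 \<le> ln (2::real)" using ln_2_less_1 ln2_ge_two_thirds by simp
    have lnr: "1/2 \<le> ln r" using ln2 r ln_le_cancel_iff[of 2 r] by linarith
    show ?thesis
    proof (rule key, cases "r < R 1")
      case True
      have "F r * r powr \<beta> \<le> 1 * r powr \<beta>" using F1 by (rule mult_right_mono) simp
      also have "\<dots> \<le> r powr 2" using powr_mono[OF \<beta>(2), of r] r by simp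
      also have "\<dots> = r\<^sup>2" using r by (simp add: powr_numeral)
      also have "\<dots> \<le> (R 1)\<^sup>2" using True r by (intro power_mono) auto
      also have "\<dots> = 16 * (R 1)\<^sup>2 * (1/2) ^ 4" by (simp add: power_divide)
      also have "\<dots> \<le> 16 * (R 1)\<^sup>2 * (ln r) ^ 4" using lnr by (intro mult_left_mono power_mono) auto
      also have "\<dots> \<le> c * (ln r) ^ 4" using C by (intro mult_right_mono) (auto simp: c_def)
      finally show "F r * r powr \<beta> \<le> c * (ln r) ^ 4" .
    next
      case False
      \<comment> \<open>Minimality gives \<open>R N \<le> r < R (Suc N)\<close> with
        \<open>M = Suc N\<close>; the values 0 and 1 are excluded because
        \<open>R 0 \<le> R 1 \<le> r\<close>.\<close>
      define M where "M = (LEAST N. r < R N)"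
      have M: "r < R M" unfolding M_def using unbounded[of r] by (rule LeastI_ex)
      have R01: "R 0 \<le> R 1"
      proof -
        have "R 0 = 4" by (simp add: R_def)
        also have "\<dots> \<le> 4 * (4 * real d * real 1 + 1) * 1" by simp
        also have "\<dots> \<le> R 1" unfolding R_def by (rule mult_left_mono) auto
        finally show ?thesis .
      qed
      have "M \<noteq> 0" "M \<noteq> 1" using M False R01 by (auto intro: ccontr)
      then obtain N where N: "M = Suc N" "1 \<le> N" by (cases M) auto
      have RN: "R N \<le> r" using not_less_Least[of N "\<lambda>N. r < R N"] N by (simp add: M_def[symmetric] not_less)
      have FN: "F r \<le> C * (1/2) ^ (2 * d * N)" by (rule F[OF N(2)]) (use RN in \<open>simp add: R_def\<close>)
      \<comment> \<open>Taking logarithms then gives \<open>N \<le> ln r\<close>, because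
        \<open>(d + 4) * ln 2 \<ge> 1\<close>.\<close>
      have "2 ^ (N * (d + 4)) \<le> R N"
      proof -
        have "1 * 2 ^ (N * (d + 4)) \<le> R N" unfolding R_def by (rule mult_right_mono) auto
        then show ?thesis by simp
      qed
      then have "ln (2 ^ (N * (d + 4))) \<le> ln r" using RN by (intro ln_mono) auto
      then have "real (N * (d + 4)) * ln 2 \<le> ln r" by (simp only: ln_realpow)
      moreover have "real N \<le> real (N * (d + 4)) * ln 2"
      proof -
        have "real N * 1 \<le> real N * (real (d + 4) * ln 2)"
        proof (rule mult_left_mono)
          have "4 * (1/2) \<le> real (d + 4) * ln 2" using ln2 by (intro mult_mono) auto
          then show "1 \<le> real (d + 4) * ln 2" by simp
        qed simp
        then show ?thesis by (simp only: of_nat_mult mult.assoc mult_1_right)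
      qed
      ultimately have lnN: "real N \<le> ln r" by simp
      define m where "m = 4 * (4 * real d * real (Suc N) + 1)"
      have m: "1 \<le> m" "m \<le> 4 * (8 * real d + 1) * real N"
      proof -
        show "1 \<le> m" by (simp add: m_def)
        have "real d * 1 \<le> real d * real N" using N(2) by (intro mult_left_mono) auto
        then show "m \<le> 4 * (8 * real d + 1) * real N" using N(2) by (simp add: m_def algebra_simps)
      qed
      have "r powr \<beta> \<le> R (Suc N) powr \<beta>" using M N r \<beta> by (intro powr_mono2) auto
      also have "\<dots> = m powr \<beta> * (2 ^ (Suc N * (d + 4))) powr \<beta>"
        unfolding R_def m_def by (rule powr_mult)
      also have "(2 ^ (Suc N * (d + 4)) :: real) powr \<beta> = 2 ^ (2 * d * Suc N)"
      proof -
        have "(2 ^ (Suc N * (d + 4)) :: real) powr \<beta> = (2 powr real (Suc N * (d + 4))) powr \<beta>"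
          by (simp only: powr_realpow zero_less_numeral)
        also have "\<dots> = 2 powr (real (Suc N) * (real (d + 4) * \<beta>))" by (simp only: powr_powr of_nat_mult mult.assoc)
        also have "\<dots> = 2 powr real (2 * d * Suc N)" by (simp only: \<beta>(3)) (simp add: algebra_simps)
        also have "\<dots> = 2 ^ (2 * d * Suc N)" by (rule powr_realpow) simp
        finally show ?thesis .
      qed
      \<comment> \<open>As \<open>m \<ge> 1\<close> is linear in \<open>N\<close> and
        \<open>\<beta> \<le> 2\<close>, this factor is at most quadratic in \<open>N\<close>, hence
        absorbed by the logarithms.\<close>
      also have "m powr \<beta> * 2 ^ (2 * d * Suc N) \<le> (4 * (8 * real d + 1) * real N)\<^sup>2 * 2 ^ (2 * d * Suc N)"
      proof (rule mult_right_mono)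
        have "m powr \<beta> \<le> m powr 2" by (rule powr_mono[OF \<beta>(2) m(1)])
        also have "\<dots> = m\<^sup>2" using m(1) by (simp add: powr_numeral)
        also have "\<dots> \<le> (4 * (8 * real d + 1) * real N)\<^sup>2" using m by (intro power_mono) auto
        finally show "m powr \<beta> \<le> (4 * (8 * real d + 1) * real N)\<^sup>2" .
      qed simp
      finally have rb: "r powr \<beta> \<le> (4 * (8 * real d + 1) * real N)\<^sup>2 * 2 ^ (2 * d * Suc N)" .
      have "F r * r powr \<beta> \<le> C * (1/2) ^ (2 * d * N) * r powr \<beta>" using FN by (rule mult_right_mono) simp
      also have "\<dots> \<le> C * (1/2) ^ (2 * d * N) * ((4 * (8 * real d + 1) * real N)\<^sup>2 * 2 ^ (2 * d * Suc N))"
        using rb C by (intro mult_left_mono) auto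
      also have "\<dots> = C * 2 ^ (2 * d) * (4 * (8 * real d + 1))\<^sup>2 * (real N)\<^sup>2 * ((1/2) ^ (2 * d * N) * 2 ^ (2 * d * N))"
      proof -
        have "2 * d * Suc N = 2 * d + 2 * d * N" by simp
        then show ?thesis by (simp only: power_add) (simp only: power_mult_distrib mult_ac)
      qed
      also have "((1/2) ^ (2 * d * N) * 2 ^ (2 * d * N) :: real) = 1"
        by (simp only: power_mult_distrib[symmetric]) simp
      also have "C * 2 ^ (2 * d) * (4 * (8 * real d + 1))\<^sup>2 * (real N)\<^sup>2 * 1 \<le>
          C * 2 ^ (2 * d) * (4 * (8 * real d + 1))\<^sup>2 * (ln r) ^ 4"
      proof -
        have "(real N)\<^sup>2 \<le> (real N) ^ 4" using N(2) by (intro power_increasing) auto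
        also have "\<dots> \<le> (ln r) ^ 4" using lnN by (intro power_mono) auto
        finally show ?thesis using C by (simp add: mult_left_mono)
      qed
      also have "\<dots> \<le> c * (ln r) ^ 4" by (intro mult_right_mono) (auto simp: c_def)
      finally show "F r * r powr \<beta> \<le> c * (ln r) ^ 4" .
    qed
  qed
  then show ?thesis unfolding \<beta>_def by blast
qed

lemma linf_norm_sball: "x \<in> sball b \<Longrightarrow> linf_norm x \<le> int b"
  by (simp add: sball_def)

section \<open>Almost sure matching and the range of the limit\<close>

context hierarchy
begin

text \<open>Being unmatched forever implies being unmatched at every stage, whose probability does
  not depend on the site and tends to 0; there are countably many sites.\<close>

lemma AE_matched:
  assumes "(\<lambda>n. measure coin_measure {\<gamma> :: ('d::finite) config. stage n \<gamma> 0 = 0}) \<longlonglongrightarrow> 0"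
  shows "AE \<gamma> in coin_measure. \<forall>x :: 'd site. \<exists>n. stage n \<gamma> x \<noteq> x"
proof -
  interpret prob_space "coin_measure :: 'd config measure" by (rule prob_space_coin)
  have "AE \<gamma> in coin_measure. \<exists>n. stage n \<gamma> x \<noteq> x" for x :: "'d site"
  proof -
    have fin: "finitary (\<lambda>\<gamma>. stage n \<gamma> x = x)" for n by (rule finitary_comp[OF finitary_stage])
    let ?A = "{\<gamma> :: 'd config. \<forall>n. stage n \<gamma> x = x}"
    have "?A = (\<Inter>n. {\<gamma>. stage n \<gamma> x = x})" by auto
    also have "\<dots> \<in> sets coin_measure" by (rule sets.countable_INT) (use finitary_sets[OF fin] in auto)
    finally have A: "?A \<in> sets coin_measure" .
    have "measure coin_measure ?A \<le> measure coin_measure {\<gamma> :: 'd config. stage n \<gamma> 0 = 0}" for n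
    proof -
      have "stage n (config_shift x \<gamma>) x = x \<longleftrightarrow> stage n \<gamma> 0 = 0" for \<gamma>
        using stage_shift[of n x \<gamma> 0] by simp
      then have "measure coin_measure {\<gamma> :: 'd config. stage n \<gamma> x = x} = measure coin_measure {\<gamma> :: 'd config. stage n \<gamma> 0 = 0}"
        using prob_shift[OF fin[of n], of x] by simp
      moreover have "measure coin_measure ?A \<le> measure coin_measure {\<gamma> :: 'd config. stage n \<gamma> x = x}"
        by (rule finite_measure_mono[OF _ finitary_sets[OF fin]]) blast
      ultimately show ?thesis by simp
    qed
    then have "measure coin_measure ?A \<le> 0" by (intro LIMSEQ_le_const[OF assms]) blast
    then have "measure coin_measure ?A = 0" by (simp add: measure_le_0_iff)
    then have "AE \<gamma> in coin_measure. \<gamma> \<notin> ?A" using prob_eq_0[OF A] by simp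
    then show ?thesis by (rule AE_mp) simp
  qed
  then show ?thesis by (simp add: AE_all_countable)
qed

text \<open>A site matched by stage \<open>n\<close> has its final partner within
  \<open>2 * reach n\<close>.\<close>

lemma prob_match_dist:
  assumes "2 * real (reach n) \<le> r"
  shows "\<P>(\<gamma> in coin_measure. real_of_int (match_dist limit_stage (\<gamma> :: ('d::finite) config)) > r)
    \<le> measure coin_measure {\<gamma> :: 'd config. stage n \<gamma> 0 = 0}"
proof -
  interpret prob_space "coin_measure :: 'd config measure" by (rule prob_space_coin)
  have "real_of_int (match_dist limit_stage \<gamma>) \<le> r" if "stage n \<gamma> 0 \<noteq> 0" for \<gamma> :: "'d config"
  proof -
    have "limit_stage \<gamma> 0 \<in> sball (2 * reach n)"
      using stage_reach[of n \<gamma> 0] limit_stage_eq[OF that] by simp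
    then have "match_dist limit_stage \<gamma> \<le> int (2 * reach n)"
      by (simp only: match_dist_def linf_norm_sball)
    then have "real_of_int (match_dist limit_stage \<gamma>) \<le> real_of_int (int (2 * reach n))"
      by (simp only: of_int_le_iff)
    also have "\<dots> \<le> r" using assms by simp
    finally show ?thesis .
  qed
  then have "{\<gamma> \<in> space coin_measure. real_of_int (match_dist limit_stage (\<gamma> :: 'd config)) > r} \<subseteq> {\<gamma>. stage n \<gamma> 0 = 0}"
    by (auto simp: not_le[symmetric])
  then show ?thesis by (rule finite_measure_mono) (rule finitary_sets[OF finitary_comp[OF finitary_stage]])
qed

end

theorem theorem1:
  shows "\<exists>(\<Phi> :: ('d::finite) config \<Rightarrow> 'd site \<Rightarrow> 'd site) (c :: real).
    matching_rule \<Phi> \<and> translation_equivariant \<Phi> \<and>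
    (\<forall>r::real. r \<ge> 2 \<longrightarrow>
      \<P>(\<gamma> in coin_measure. real_of_int (match_dist \<Phi> \<gamma>) > r)
        \<le> c * (ln r) ^ 4 * r powr - (2 / (1 + 4 / real CARD('d))))"
proof -
  define d where "d = CARD('d)"
  have d: "1 \<le> d" unfolding d_def by (simp add: Suc_leI)
  \<comment> \<open>At level \<open>n\<close> the cells have radius of order \<open>n 2^(n (d + 4))\<close> and the seeds density
    \<open>2^(-4 d n)\<close>, so a fraction of order \<open>2^(-2 d n)\<close> stays unmatched, which is the radius to
    the power \<open>-\<beta>\<close> up to a power of \<open>n\<close>.\<close>
  define k where "k n = 4 * d * Suc n" for n :: nat
  define t :: "nat \<Rightarrow> nat" where "t n = 2 ^ (Suc n * (d + 4))" for n
  define b where "b n = Suc (k n) * t n" for n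
  interpret hierarchy k b
  proof
    fix n
    have "4 * 1 * 1 \<le> 4 * d * Suc n" using d by (intro mult_mono) auto
    then show "2 \<le> k n" by (simp add: k_def)
  qed
  interpret prob_space "coin_measure :: 'd config measure" by (rule prob_space_coin)
  have unmatched: "measure coin_measure {\<gamma> :: 'd config. stage N \<gamma> 0 = 0} \<le> 2500 * (1/2) ^ (2 * d * N)"
    if N1: "1 \<le> N" for N
  proof -
    obtain n where n: "N = Suc n" using N1 by (cases N) auto
    \<comment> \<open>The square root of \<open>(1/2) ^ (4 * d * N)\<close>, the bound on the seed
      density; it balances both terms of \<open>prob_unmatched_le\<close>.\<close>
    define l :: real where "l = (1/2) ^ (2 * d * N)"
    have l: "0 < l" by (simp add: l_def)
    have "4 * d * N = 2 * d * N + 2 * d * N" by simp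
    then have ll: "(1/2) ^ (4 * d * N) = l * l" by (simp only: l_def power_add)
    have kN: "k n = 4 * d * N" by (simp only: k_def n)
    have "measure coin_measure {\<gamma> :: 'd config. \<exists>x. ctr N \<gamma> x = 0} \<le>
      measure coin_measure {\<gamma> :: 'd config. seed (k n) \<gamma> 0} +
      measure coin_measure {\<gamma> :: 'd config. \<forall>v\<in>sball (Suc (k n) * t n). \<not> seed (k n) \<gamma> v}"
      using prob_centre[of n, where 'd='d] unfolding n b_def .
    also have "\<dots> \<le> (1/2) ^ (k n) + (1 - (1/2) ^ Suc (k n)) ^ (t n ^ CARD('d))"
      by (rule add_mono[OF prob_seed prob_no_seed])
    also have "\<dots> \<le> l * l + 4096 * (l * l)"
      using no_seed_bound[OF d, of N] unfolding kN t_def n[symmetric] d_def[symmetric] ll[symmetric] by simp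
    finally have "measure coin_measure {\<gamma> :: 'd config. \<exists>x. ctr N \<gamma> x = 0} / l \<le> 4097 * l"
      using l by (simp add: field_simps)
    \<comment> \<open>The constant is \<open>(768 + 4097) / 2\<close>, rounded up to 2500.\<close>
    then show ?thesis
      using prob_unmatched_le[OF l, of N, where 'd='d] l by (simp add: l_def[symmetric])
  qed
  \<comment> \<open>The hop radii at least double from level to level, so their sum is at most twice
    the last one.\<close>
  have reach: "real (reach N) \<le> 2 * (4 * real d * real N + 1) * 2 ^ (N * (d + 4))" for N
  proof (induction N)
    case 0
    show ?case by (simp add: reach_def)
  next
    case (Suc N)
    let ?q = "4 * real d * real (Suc N) + 1" and ?M = "2 ^ (N * (d + 4)) :: real" and ?D = "2 ^ (d + 4) :: real"
    have D: "2 * ?M \<le> ?D * ?M"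
      by (rule mult_right_mono) (use power_increasing[of 1 "d + 4" "2::real"] in auto)
    have "real (reach (Suc N)) = real (reach N) + ?q * (?D * ?M)"
      by (simp add: reach_def b_def k_def t_def power_add algebra_simps)
    also have "\<dots> \<le> 2 * ?q * ?M + ?q * (?D * ?M)"
    proof -
      have "2 * (4 * real d * real N + 1) * ?M \<le> 2 * ?q * ?M"
        by (intro mult_right_mono mult_left_mono add_right_mono) auto
      with Suc show ?thesis by linarith
    qed
    also have "\<dots> \<le> ?q * (?D * ?M) + ?q * (?D * ?M)"
    proof -
      have "?q * (2 * ?M) \<le> ?q * (?D * ?M)" by (rule mult_left_mono[OF D]) simp
      then show ?thesis by (simp only: mult_ac add_le_cancel_right)
    qed
    also have "\<dots> = 2 * ?q * 2 ^ (Suc N * (d + 4))" by (simp add: power_add algebra_simps)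
    finally show ?case .
  qed
  define F where "F r = \<P>(\<gamma> in coin_measure. real_of_int (match_dist limit_stage (\<gamma> :: 'd config)) > r)" for r
  have "\<exists>c. \<forall>r\<ge>2. F r \<le> c * (ln r) ^ 4 * r powr - (2 / (1 + 4 / real d))"
  proof (rule tail_interpolation[OF d])
    show "F r \<le> 1" for r by (simp add: F_def)
    fix N r assume N: "1 \<le> N" and r: "4 * (4 * real d * real N + 1) * 2 ^ (N * (d + 4)) \<le> r"
    \<comment> \<open>The factor 4 in the scale is this 2, from \<open>stage_reach\<close>, times
      the 2 in \<open>reach\<close>.\<close>
    have "2 * real (reach N) \<le> r" using reach[of N] r unfolding mult.assoc by linarith
    from prob_match_dist[OF this, where 'd='d] unmatched[OF N]
    show "F r \<le> 2500 * (1/2) ^ (2 * d * N)" unfolding F_def by (rule order_trans)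
  qed simp
  then obtain c where c: "\<And>r. 2 \<le> r \<Longrightarrow> F r \<le> c * (ln r) ^ 4 * r powr - (2 / (1 + 4 / real d))" by blast
  have lim: "(\<lambda>n. measure coin_measure {\<gamma> :: 'd config. stage n \<gamma> 0 = 0}) \<longlonglongrightarrow> 0"
  proof (rule tendsto_sandwich[OF _ _ tendsto_const])
    show "\<forall>\<^sub>F n in sequentially. 0 \<le> measure coin_measure {\<gamma> :: 'd config. stage n \<gamma> 0 = 0}" by simp
    show "\<forall>\<^sub>F n in sequentially. measure coin_measure {\<gamma> :: 'd config. stage n \<gamma> 0 = 0} \<le> 2500 * ((1/2) ^ (2 * d)) ^ n"
      using eventually_ge_at_top[of 1] by eventually_elim (simp only: power_mult[symmetric] unmatched)
    have "(1/2 :: real) ^ (2 * d) \<le> (1/2) ^ 1" by (rule power_decreasing) (use d in auto)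
    then have "(1/2 :: real) ^ (2 * d) < 1" by simp
    then have "(\<lambda>n. ((1/2 :: real) ^ (2 * d)) ^ n) \<longlonglongrightarrow> 0" by (intro LIMSEQ_realpow_zero) auto
    then show "(\<lambda>n. 2500 * ((1/2 :: real) ^ (2 * d)) ^ n) \<longlonglongrightarrow> 0" by (rule tendsto_mult_right_zero)
  qed
  have "AE \<gamma> in coin_measure. matching_on \<gamma> (limit_stage (\<gamma> :: 'd config))"
    using AE_matched[OF lim] by (rule AE_mp) (auto intro!: AE_I2 matching_on_limit_stage)
  then have "matching_rule (limit_stage :: 'd config \<Rightarrow> _)"
    by (simp add: matching_rule_def measurable_limit_stage)
  moreover have "translation_equivariant (limit_stage :: 'd config \<Rightarrow> _)"
    by (simp add: translation_equivariant_def site_shift_def limit_stage_shift)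
  ultimately show ?thesis using c unfolding F_def d_def by blast
qed

end
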